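(* Let $T$ be a finite tree with root $r$ and positive edge weights, let $B>1$ be real with every vertex at distance at most $B/2$ from $r$, and fix a depth first search traversal of $T$. Suppose $T$ is heavy, i.e. $\omega(T)>\varphi(T)=B/2$. Then: (i) if $\mathrm{heavydeg}(r)=1$, then $\mathrm{cost}(\mathrm{ADFS}(T))<10\cdot\mathrm{cost}(C_{\mathrm{opt}}(T))-8\varphi(T)$; (ii) if $\mathrm{heavydeg}(r)\ne1$, then $\mathrm{cost}(\mathrm{ADFS}(T))<10\cdot\mathrm{cost}(C_{\mathrm{opt}}(T))-16\varphi(T)$.
   Context: $d$ is the weighted tree distance; the potential of a vertex $u$ is $\varphi(u)=B/2-d(r,u)$ and $\varphi(T)=\varphi(r)=B/2$. For a subtree $T'$, $\omega(T')$ is the total weight of its edges. For an edge $e=\{u,w\}$ with $u$ the parent of $w$, $T_e$ is the subtree consisting of $e$, $w$ and all descendants of $w$, rooted at $u$; $e$ is heavy if $\omega(T_e)>\varphi(u)$, and $\mathrm{heavydeg}(r)$ is the number of heavy edges from $r$ to its children. A route is a closed walk starting and ending at $r$; its length is the total weight of traversed edges (with multiplicity). A $B$-exploration strategy is a finite sequence of routes each of length at most $B$ together visiting all vertices; its cost is the total length of its routes; $C_{\mathrm{opt}}(T)$ is one of minimum cost. Given the fixed DFS traversal $(v_0,\dots,v_l)$, for $0\le B'\le B$ the $B'$-adversarial DFS $B$-exploration $\mathrm{ADFS}_{B'}(T)=(R_1,\dots,R_k)$ is: $j_0=0$; $j_1$ is the largest $p\le l$ with $\mathrm{len}(v_0,\dots,v_p)+d(v_p,r)\le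 B'$; for $i\ge2$, $j_i$ is the largest $p\le l$, $p\ge j_{i-1}$, with $d(r,v_{j_{i-1}})+\mathrm{len}(v_{j_{i-1}},\dots,v_p)+d(v_p,r)\le B$; $R_i$ is the path from $r$ to $v_{j_{i-1}}$, then the walk $(v_{j_{i-1}},\dots,v_{j_i})$, then the path back to $r$; stop when $j_i=l$. $\mathrm{cost}(\mathrm{ADFS}(T))=\max_{0\le B'\le B}\mathrm{cost}(\mathrm{ADFS}_{B'}(T))$. *)

theory Defs
  imports Complex_Main
begin

text \<open>Edges are two-element sets of vertices, and walks are nonempty lists of vertices.
  The \<open>tree\<close> predicate of the AFP entry Graph\_Theory only excludes directed cycles: a symmetric
  digraph with an edge is not a tree there, whereas a diamond-shaped DAG is. Hence the usual
  notion for undirected graphs is defined here.\<close>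

record 'a wtree =
  verts :: "'a set"
  edges :: "'a set set"
  weight :: "'a set \<Rightarrow> real"
  root :: 'a

definition walk :: "'a wtree \<Rightarrow> 'a list \<Rightarrow> bool" where
  "walk T p \<longleftrightarrow> p \<noteq> [] \<and> set p \<subseteq> verts T \<and> successively (\<lambda>x y. {x, y} \<in> edges T) p"

definition walk_betw :: "'a wtree \<Rightarrow> 'a \<Rightarrow> 'a list \<Rightarrow> 'a \<Rightarrow> bool" where
  "walk_betw T u p v \<longleftrightarrow> walk T p \<and> hd p = u \<and> last p = v"

definition cycle :: "'a wtree \<Rightarrow> 'a list \<Rightarrow> bool" where
  "cycle T p \<longleftrightarrow> walk T p \<and> distinct p \<and> length p \<ge> 3 \<and> {last p, hd p} \<in> edges T"

definition weighted_rooted_tree :: "'a wtree \<Rightarrow> bool" where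
  "weighted_rooted_tree T \<longleftrightarrow>
     finite (verts T) \<and> root T \<in> verts T \<and>
     edges T \<subseteq> {{u, v} | u v. u \<in> verts T \<and> v \<in> verts T \<and> u \<noteq> v} \<and>
     (\<forall>u\<in>verts T. \<forall>v\<in>verts T. \<exists>p. walk_betw T u p v) \<and>
     (\<nexists>p. cycle T p) \<and>
     (\<forall>e\<in>edges T. weight T e > 0)"

fun len :: "'a wtree \<Rightarrow> 'a list \<Rightarrow> real" where
  "len T (x # y # p) = weight T {x, y} + len T (y # p)"
| "len T _ = 0"

definition tree_path :: "'a wtree \<Rightarrow> 'a \<Rightarrow> 'a \<Rightarrow> 'a list" where
  "tree_path T u v = (THE p. walk_betw T u p v \<and> distinct p)"

definition tdist :: "'a wtree \<Rightarrow> 'a \<Rightarrow> 'a \<Rightarrow> real" where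
  "tdist T u v = len T (tree_path T u v)"

definition omega :: "'a wtree \<Rightarrow> real" where
  "omega T = (\<Sum>e\<in>edges T. weight T e)"

definition potential :: "'a wtree \<Rightarrow> real \<Rightarrow> 'a \<Rightarrow> real" where
  "potential T B u = B / 2 - tdist T (root T) u"

definition tree_potential :: "'a wtree \<Rightarrow> real \<Rightarrow> real" where
  "tree_potential T B = potential T B (root T)"

definition heavy_tree :: "'a wtree \<Rightarrow> real \<Rightarrow> bool" where
  "heavy_tree T B \<longleftrightarrow> omega T > tree_potential T B"

definition children :: "'a wtree \<Rightarrow> 'a \<Rightarrow> 'a set" where
  "children T u = {x \<in> verts T. {u, x} \<in> edges T \<and> u \<in> set (tree_path T (root T) x)}"

text \<open>Every vertex is a descendant of itself.\<close>

definition descendants :: "'a wtree \<Rightarrow> 'a \<Rightarrow> 'a set" where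
  "descendants T x = {y \<in> verts T. x \<in> set (tree_path T (root T) y)}"

text \<open>The subtree \<open>T\<^sub>e\<close> for \<open>e = {u, x}\<close> with \<open>u\<close> the parent of \<open>x\<close>.\<close>

definition edge_subtree :: "'a wtree \<Rightarrow> 'a \<Rightarrow> 'a \<Rightarrow> 'a wtree" where
  "edge_subtree T u x =
     T\<lparr>verts := insert u (descendants T x),
       edges := insert {u, x} {e \<in> edges T. e \<subseteq> descendants T x},
       root := u\<rparr>"

text \<open>The potential of \<open>u\<close> is taken in the whole tree \<open>T\<close>, not in the subtree.\<close>

definition heavy_edge :: "'a wtree \<Rightarrow> real \<Rightarrow> 'a \<Rightarrow> 'a \<Rightarrow> bool" where
  "heavy_edge T B u x \<longleftrightarrow> x \<in> children T u \<and> omega (edge_subtree T u x) > potential T B u"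

definition heavydeg :: "'a wtree \<Rightarrow> real \<Rightarrow> 'a \<Rightarrow> nat" where
  "heavydeg T B u = card {{u, x} | x. heavy_edge T B u x}"

definition route :: "'a wtree \<Rightarrow> 'a list \<Rightarrow> bool" where
  "route T R \<longleftrightarrow> walk_betw T (root T) R (root T)"

definition exploration_strategy :: "'a wtree \<Rightarrow> real \<Rightarrow> 'a list list \<Rightarrow> bool" where
  "exploration_strategy T B S \<longleftrightarrow>
     (\<forall>R\<in>set S. route T R \<and> len T R \<le> B) \<and> verts T \<subseteq> (\<Union>R\<in>set S. set R)"

definition cost :: "'a wtree \<Rightarrow> 'a list list \<Rightarrow> real" where
  "cost T S = (\<Sum>R\<leftarrow>S. len T R)"

definition optimal_strategy :: "'a wtree \<Rightarrow> real \<Rightarrow> 'a list list \<Rightarrow> bool" where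
  "optimal_strategy T B C \<longleftrightarrow>
     exploration_strategy T B C \<and> (\<forall>S. exploration_strategy T B S \<longrightarrow> cost T C \<le> cost T S)"

text \<open>\<open>dfs_from T u vs\<close>: the closed walk \<open>vs\<close> is a depth first search traversal of the part of
  \<open>T\<close> at and below \<open>u\<close>, the children of \<open>u\<close> being explored in the order \<open>cs\<close>.\<close>

inductive dfs_from :: "'a wtree \<Rightarrow> 'a \<Rightarrow> 'a list \<Rightarrow> bool" for T :: "'a wtree" where
  "distinct cs \<Longrightarrow> set cs = children T u \<Longrightarrow> list_all2 (dfs_from T) cs tss \<Longrightarrow>
     dfs_from T u (u # concat (map (\<lambda>ts. ts @ [u]) tss))"

definition dfs_traversal :: "'a wtree \<Rightarrow> 'a list \<Rightarrow> bool" where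
  "dfs_traversal T vs \<longleftrightarrow> dfs_from T (root T) vs"

text \<open>A traversal \<open>(v\<^sub>0, \<dots>, v\<^sub>l)\<close> is a list \<open>vs\<close> with \<open>v\<^sub>i = vs ! i\<close> and \<open>l = length vs - 1\<close>.\<close>

definition segment :: "'a list \<Rightarrow> nat \<Rightarrow> nat \<Rightarrow> 'a list" where
  "segment vs i p = take (Suc p - i) (drop i vs)"

fun adfs_index :: "'a wtree \<Rightarrow> real \<Rightarrow> 'a list \<Rightarrow> real \<Rightarrow> nat \<Rightarrow> nat" where
  "adfs_index T B vs B' 0 = 0"
| "adfs_index T B vs B' (Suc 0) =
     Max {p. p \<le> length vs - 1 \<and> len T (segment vs 0 p) + tdist T (vs ! p) (root T) \<le> B'}"
| "adfs_index T B vs B' (Suc (Suc i)) =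
     (let j = adfs_index T B vs B' (Suc i) in
      Max {p. p \<le> length vs - 1 \<and> j \<le> p \<and>
              tdist T (root T) (vs ! j) + len T (segment vs j p) + tdist T (vs ! p) (root T) \<le> B})"

definition adfs_route :: "'a wtree \<Rightarrow> real \<Rightarrow> 'a list \<Rightarrow> real \<Rightarrow> nat \<Rightarrow> 'a list" where
  "adfs_route T B vs B' i =
     (let j = adfs_index T B vs B' (i - 1); p = adfs_index T B vs B' i in
      tree_path T (root T) (vs ! j) @ tl (segment vs j p) @ tl (tree_path T (vs ! p) (root T)))"

definition adfs_count :: "'a wtree \<Rightarrow> real \<Rightarrow> 'a list \<Rightarrow> real \<Rightarrow> nat" where
  "adfs_count T B vs B' = (LEAST k. k \<ge> 1 \<and> adfs_index T B vs B' k = length vs - 1)"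

definition adfs :: "'a wtree \<Rightarrow> real \<Rightarrow> 'a list \<Rightarrow> real \<Rightarrow> 'a list list" where
  "adfs T B vs B' = map (adfs_route T B vs B') [1..<Suc (adfs_count T B vs B')]"

text \<open>The set below is finite, as \<open>adfs T B vs B'\<close> depends on \<open>B'\<close> only through the first index.\<close>

definition adfs_cost :: "'a wtree \<Rightarrow> real \<Rightarrow> 'a list \<Rightarrow> real" where
  "adfs_cost T B vs = Max ((\<lambda>B'. cost T (adfs T B vs B')) ` {0..B})"

end

theory Submission
  imports Defs
begin

text \<open>Follow the traversal and record the slack: the unused budget if the current route returned to
  the root at once. A step down an edge of weight \<open>w\<close> costs \<open>2 w\<close>, a step up is free, and a new route
  starts at a vertex \<open>s\<close> with slack \<open>2 \<phi>(s)\<close>. The strategy costs at most \<open>2 \<omega>(T)\<close> plus twice the sum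
  of the depths of the vertices at which it stops.

  Bottom up, every strategy uses at least \<open>n(u) = max 1 \<lceil>L(u) / (2 \<phi>(u))\<rceil>\<close> routes below a vertex
  \<open>u\<close>, where \<open>L(u)\<close> sums \<open>L(c) + 2 w n(c)\<close> over the children \<open>c\<close>; hence \<open>L(r)\<close> bounds its cost from
  below. It remains to bound the number of stops below \<open>u\<close> by \<open>10 n(u) - 9\<close>. A light subtree has at
  most one. For a heavy one the invariant also records whether the slack on entry and on exit is
  small compared to the surplus \<open>2 \<phi>(u) n(u) - L(u)\<close>: both quantities are unchanged when passing
  from \<open>u\<close> to its parent and drop in the same way when light subtrees are attached, so that the stops
  along a chain of heavy edges are paid for by increments of \<open>n\<close>.\<close>

subsection \<open>Slack and stops on ordered weighted forests\<close>

text \<open>The order of \<open>kids\<close> is the order in which the depth first search visits the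
  children. Weights are not stored: an edge weighs the drop of the potential \<open>f\<close> along
  it.\<close>

datatype (labels: 'a) rose = Node (label: 'a) (kids: "'a rose list")

fun decreasing :: "('a \<Rightarrow> real) \<Rightarrow> 'a \<Rightarrow> 'a rose list \<Rightarrow> bool" where
  "decreasing f u [] \<longleftrightarrow> True"
| "decreasing f u (Node c ss # ts) \<longleftrightarrow> 0 \<le> f c \<and> f c < f u \<and> decreasing f c ss \<and> decreasing f u ts"

fun forest_weight :: "('a \<Rightarrow> real) \<Rightarrow> 'a \<Rightarrow> 'a rose list \<Rightarrow> real" where
  "forest_weight f u [] = 0"
| "forest_weight f u (Node c ss # ts) = forest_weight f c ss + (f u - f c) + forest_weight f u ts"

text \<open>A route can spend at most \<open>2 * x\<close> below a vertex of potential
  \<open>x\<close>, so traffic \<open>p\<close> there needs this many routes. For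
  \<open>x = 0\<close> the quotient is 0 and the value is 1.\<close>

definition route_bound :: "real \<Rightarrow> real \<Rightarrow> int" where
  "route_bound x p = max 1 \<lceil>p / (2 * x)\<rceil>"

fun lower_bound :: "('a \<Rightarrow> real) \<Rightarrow> 'a \<Rightarrow> 'a rose list \<Rightarrow> real" where
  "lower_bound f u [] = 0"
| "lower_bound f u (Node c ss # ts) =
     lower_bound f c ss + 2 * (f u - f c) * route_bound (f c) (lower_bound f c ss) + lower_bound f u ts"

text \<open>If the slack is too small, the step is made after a fresh start at \<open>u\<close> with
  slack \<open>2 * f u\<close>; paying \<open>2 * (f u - f c)\<close> leaves
  \<open>2 * f c\<close>.\<close>

definition descend :: "('a \<Rightarrow> real) \<Rightarrow> 'a \<Rightarrow> 'a \<Rightarrow> real \<Rightarrow> real" where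
  "descend f u c g = (if 2 * (f u - f c) \<le> g then g - 2 * (f u - f c) else 2 * f c)"

fun slack_out :: "('a \<Rightarrow> real) \<Rightarrow> 'a \<Rightarrow> 'a rose list \<Rightarrow> real \<Rightarrow> real" where
  "slack_out f u [] g = g"
| "slack_out f u (Node c ss # ts) g = slack_out f u ts (slack_out f c ss (descend f u c g))"

fun stops :: "('a \<Rightarrow> real) \<Rightarrow> 'a \<Rightarrow> 'a rose list \<Rightarrow> real \<Rightarrow> 'a list" where
  "stops f u [] g = []"
| "stops f u (Node c ss # ts) g =
     (if 2 * (f u - f c) \<le> g then [] else [u]) @ stops f c ss (descend f u c g) @
     stops f u ts (slack_out f c ss (descend f u c g))"

lemma decreasing_append [simp]:
  "decreasing f u (xs @ ys) \<longleftrightarrow> decreasing f u xs \<and> decreasing f u ys"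
  by (induction f u xs rule: decreasing.induct) auto

lemma lower_bound_append [simp]:
  "lower_bound f u (xs @ ys) = lower_bound f u xs + lower_bound f u ys"
  by (induction f u xs rule: lower_bound.induct) auto

lemma slack_out_append [simp]:
  "slack_out f u (xs @ ys) g = slack_out f u ys (slack_out f u xs g)"
  by (induction f u xs g rule: slack_out.induct) auto

lemma stops_append [simp]:
  "stops f u (xs @ ys) g = stops f u xs g @ stops f u ys (slack_out f u xs g)"
  by (induction f u xs g rule: stops.induct) auto

lemma forest_weight_nonneg: "decreasing f u ts \<Longrightarrow> 0 \<le> forest_weight f u ts"
  by (induction f u ts rule: forest_weight.induct) auto

lemma route_bound_ge_1: "1 \<le> route_bound x p"
  by (simp add: route_bound_def)

lemma lower_bound_ge: "decreasing f u ts \<Longrightarrow> 2 * forest_weight f u ts \<le> lower_bound f u ts"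
proof (induction f u ts rule: forest_weight.induct)
  case (2 f u c ss ts)
  have dec: "decreasing f c ss" "decreasing f u ts" "f c < f u" using "2.prems" by auto
  define x where "x = 2 * (f u - f c) * route_bound (f c) (lower_bound f c ss)"
  have "2 * (f u - f c) * 1 \<le> x"
    unfolding x_def
    using dec(3) route_bound_ge_1[of "f c" "lower_bound f c ss"] by (intro mult_left_mono) auto
  then show ?case
    using "2.IH"(1)[OF dec(1)] "2.IH"(2)[OF dec(2)]
    unfolding lower_bound.simps forest_weight.simps x_def[symmetric] by argo
qed simp

lemma le_route_bound: "0 < x \<Longrightarrow> p \<le> 2 * x * route_bound x p"
proof -
  assume x: "0 < x"
  have "p / (2 * x) \<le> route_bound x p"
    unfolding route_bound_def by linarith
  with x show ?thesis by (simp add: field_simps)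
qed

lemma route_bound_less: "0 < x \<Longrightarrow> 0 < p \<Longrightarrow> 2 * x * (real_of_int (route_bound x p) - 1) < p"
proof -
  assume x: "0 < x" and p: "0 < p"
  then have "0 < p / (2 * x)" by simp
  then have "real_of_int (route_bound x p) - 1 < p / (2 * x)"
    unfolding route_bound_def by linarith
  with x show ?thesis by (simp add: field_simps)
qed

lemma route_bound_le_iff: "0 < x \<Longrightarrow> 1 \<le> k \<Longrightarrow> route_bound x p \<le> k \<longleftrightarrow> p \<le> 2 * x * k"
  by (simp add: route_bound_def ceiling_le_iff field_simps)

lemma route_bound_eqI:
  assumes "0 < x" "1 \<le> k" "p \<le> 2 * x * k" "2 * x * (real_of_int k - 1) < p"
  shows "route_bound x p = k"
proof (rule antisym)
  show "route_bound x p \<le> k" using assms by (simp add: route_bound_le_iff)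
  have "2 * x * (real_of_int k - 1) < 2 * x * route_bound x p"
    using assms(4) le_route_bound[OF assms(1), of p] by linarith
  then have "real_of_int k - 1 < route_bound x p" using assms(1) by simp
  then show "k \<le> route_bound x p" by linarith
qed

lemma potential_pos:
  assumes "decreasing f u ts" "ts \<noteq> []"
  shows "0 < f u"
proof (cases ts)
  case (Cons t ts')
  with assms(1) show ?thesis by (cases t) auto
qed (use assms in simp)

lemma heavy_potential_pos:
  assumes "decreasing f u ts" "0 \<le> f u" "f u < forest_weight f u ts"
  shows "0 < f u"
  using assms by (intro potential_pos) auto

section \<open>Slack bounds and light forests\<close>

lemma slack_out_bounds:
  assumes "decreasing f u ts" "0 \<le> g" "g \<le> 2 * f u"
  shows "0 \<le> slack_out f u ts g" "slack_out f u ts g \<le> 2 * f u"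
proof -
  have "0 \<le> slack_out f u ts g \<and> slack_out f u ts g \<le> 2 * f u"
    using assms
  proof (induction f u ts g rule: slack_out.induct)
    case (2 f u c ss ts g)
    have "0 \<le> descend f u c g \<and> descend f u c g \<le> 2 * f c"
      using 2 by (auto simp: descend_def)
    with 2 show ?case by simp
  qed simp
  then show "0 \<le> slack_out f u ts g" "slack_out f u ts g \<le> 2 * f u" by auto
qed

lemma descend_bounds:
  assumes "0 \<le> f c" "0 \<le> g" "g \<le> 2 * f u"
  shows "0 \<le> descend f u c g" "descend f u c g \<le> 2 * f c"
  using assms by (auto simp: descend_def)

text \<open>After a stop at or below the edge to the first child \<open>c\<close>, at least
  \<open>2 * f c - 2 * wc\<close> is left when the walk returns to \<open>u\<close>, and
  \<open>wc + wt \<le> f c\<close> makes this enough for the remaining siblings. So no second stop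
  occurs.\<close>

lemma light_run:
  assumes "decreasing f u ts" "forest_weight f u ts \<le> f u" "0 \<le> g" "g \<le> 2 * f u"
  shows "if 2 * forest_weight f u ts \<le> g
    then stops f u ts g = [] \<and> slack_out f u ts g = g - 2 * forest_weight f u ts
    else length (stops f u ts g) = 1 \<and> 2 * f u - 2 * forest_weight f u ts \<le> slack_out f u ts g"
  using assms
proof (induction f u ts g rule: stops.induct)
  case (2 f u c ss ts g)
  define d where "d = descend f u c g"
  define o1 where "o1 = slack_out f c ss d"
  define wc where "wc = forest_weight f c ss"
  define wt where "wt = forest_weight f u ts"
  have dec: "0 \<le> f c" "f c < f u" "decreasing f c ss" "decreasing f u ts"
    using "2.prems"(1) by auto
  have total: "forest_weight f u (Node c ss # ts) = wc + (f u - f c) + wt"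
    by (simp add: wc_def wt_def)
  have nn: "0 \<le> wc" "0 \<le> wt"
    using dec forest_weight_nonneg by (auto simp: wc_def wt_def)
  have le: "wc \<le> f c" "wt \<le> f u" "wc + wt \<le> f c"
    using "2.prems"(2) nn dec unfolding total by linarith+
  have d: "0 \<le> d" "d \<le> 2 * f c"
    unfolding d_def using descend_bounds[of f c g u, OF dec(1) "2.prems"(3,4)] by auto
  have o1: "0 \<le> o1" "o1 \<le> 2 * f u"
    using slack_out_bounds[of f c ss d, OF dec(3) d] dec(2) by (auto simp: o1_def)
  have IH1: "if 2 * wc \<le> d then stops f c ss d = [] \<and> o1 = d - 2 * wc
    else length (stops f c ss d) = 1 \<and> 2 * f c - 2 * wc \<le> o1"
    using "2.IH"(1)[folded d_def, OF dec(3) le(1)[unfolded wc_def] d] unfolding wc_def o1_def .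
  have IH2: "if 2 * wt \<le> o1 then stops f u ts o1 = [] \<and> slack_out f u ts o1 = o1 - 2 * wt
    else length (stops f u ts o1) = 1 \<and> 2 * f u - 2 * wt \<le> slack_out f u ts o1"
    using "2.IH"(2)[folded d_def, folded o1_def, OF dec(4) le(2)[unfolded wt_def] o1] unfolding wt_def .
  have st: "stops f u (Node c ss # ts) g =
      (if 2 * (f u - f c) \<le> g then [] else [u]) @ stops f c ss d @ stops f u ts o1"
    "slack_out f u (Node c ss # ts) g = slack_out f u ts o1"
    by (simp_all add: d_def o1_def)
  show ?case
  proof (cases "2 * (f u - f c) \<le> g")
    case True
    then have d': "d = g - 2 * (f u - f c)" by (simp add: d_def descend_def)
    show ?thesis
    proof (cases "2 * wc \<le> d")
      case wc: True
      then show ?thesis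
        using True d' nn dec(2) IH1 IH2 unfolding st total by (cases "2 * wt \<le> o1") simp_all
    next
      case False
      then have "2 * wt \<le> o1" using IH1 le by simp
      then show ?thesis using True False d' nn dec(2) IH1 IH2 unfolding st total by simp
    qed
  next
    \<comment> \<open>The stop is at \<open>u\<close> itself: past the edge the new route has
      \<open>2 * f c\<close>, enough for the light subtree of \<open>c\<close> and then for the
      siblings.\<close>
    case False
    then have d': "d = 2 * f c" by (simp add: d_def descend_def)
    then have "o1 = 2 * f c - 2 * wc" "stops f c ss d = []" using IH1 le by simp_all
    then show ?thesis
      using False nn le IH2 unfolding st total by simp
  qed
qed simp

text \<open>Lightness is inherited by the children, so each \<open>route_bound\<close> inside is 1
  and each edge is counted exactly twice.\<close>

lemma light_lower_bound:
  assumes "decreasing f u ts" "forest_weight f u ts \<le> f u"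
  shows "lower_bound f u ts = 2 * forest_weight f u ts"
  using assms
proof (induction f u ts rule: lower_bound.induct)
  case (2 f u c ss ts)
  have nn: "0 \<le> forest_weight f c ss" "0 \<le> forest_weight f u ts"
    using 2 forest_weight_nonneg by auto
  then have c: "forest_weight f c ss \<le> f c" using 2 by auto
  have LB: "lower_bound f c ss = 2 * forest_weight f c ss"
    using "2.IH"(1) 2 c by auto
  have "route_bound (f c) (lower_bound f c ss) = 1"
  proof (cases "f c = 0")
    case False
    then have "route_bound (f c) (lower_bound f c ss) \<le> 1"
      using LB c 2 by (subst route_bound_le_iff) auto
    then show ?thesis using route_bound_ge_1[of "f c" "lower_bound f c ss"] by linarith
  qed (simp add: route_bound_def)
  with 2 nn LB show ?case by auto
qed simp

lemma heavy_route_bound: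
  assumes "decreasing f u ts" "0 \<le> f u" "f u < forest_weight f u ts"
  shows "2 \<le> route_bound (f u) (lower_bound f u ts)"
proof (rule ccontr)
  assume "\<not> ?thesis"
  then have "lower_bound f u ts \<le> 2 * f u"
    using route_bound_le_iff[of "f u" 1 "lower_bound f u ts"] heavy_potential_pos[of f u ts, OF assms] by auto
  with lower_bound_ge[OF assms(1)] assms(3) show False by linarith
qed

section \<open>The surplus and the invariant for heavy forests\<close>

definition surplus :: "('a \<Rightarrow> real) \<Rightarrow> 'a \<Rightarrow> 'a rose list \<Rightarrow> real" where
  "surplus f u ts = 2 * f u * route_bound (f u) (lower_bound f u ts) - lower_bound f u ts"

text \<open>The constant 13 is what merging two heavy subtrees requires: 8 as their bounds \<open>n\<close> may add up to
  one more than \<open>n(u)\<close>, 3 for the groups of light subtrees before, between and after them, and 2 for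
  the indicators in \<open>few_stops\<close>.\<close>

definition stop_bound :: "('a \<Rightarrow> real) \<Rightarrow> 'a \<Rightarrow> 'a rose list \<Rightarrow> real" where
  "stop_bound f u ts = 8 * real_of_int (route_bound (f u) (lower_bound f u ts)) + lower_bound f u ts / f u - 13"

text \<open>An indicator equal to 1 strengthens the bound by one stop. This reserve absorbs a stop
  made on the edge above the forest or in light trees beside it, where the indicator of the larger
  forest turns out to be 0.\<close>

definition few_stops :: "('a \<Rightarrow> real) \<Rightarrow> 'a \<Rightarrow> 'a rose list \<Rightarrow> bool" where
  "few_stops f u ts \<longleftrightarrow> (\<forall>g. 0 \<le> g \<longrightarrow> g \<le> 2 * f u \<longrightarrow>
     length (stops f u ts g) + of_bool (2 * f u - surplus f u ts \<le> g) +
       of_bool (slack_out f u ts g < surplus f u ts) \<le> stop_bound f u ts)"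

lemma length_stops_le:
  assumes "few_stops f u ts" "0 \<le> g" "g \<le> 2 * f u"
  shows "length (stops f u ts g) \<le> stop_bound f u ts"
proof -
  have "length (stops f u ts g) + of_bool (2 * f u - surplus f u ts \<le> g) +
      of_bool (slack_out f u ts g < surplus f u ts) \<le> stop_bound f u ts"
    using assms unfolding few_stops_def by blast
  moreover have "(0::real) \<le> of_bool (2 * f u - surplus f u ts \<le> g)"
    "(0::real) \<le> of_bool (slack_out f u ts g < surplus f u ts)"
    by simp_all
  ultimately show ?thesis by linarith
qed

text \<open>Let \<open>n\<close> be the bound at \<open>c\<close>. The edge raises
  \<open>lower_bound\<close> and the budget of \<open>n\<close> routes by the same
  \<open>2 * (f u - f c) * n\<close>, but the budget of \<open>n - 1\<close> routes by less. So
  \<open>n\<close> still suffices and \<open>n - 1\<close> still fails.\<close>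

lemma route_bound_single:
  assumes "decreasing f u [Node c ss]" "f c < forest_weight f c ss"
  shows "route_bound (f u) (lower_bound f u [Node c ss]) = route_bound (f c) (lower_bound f c ss)"
proof -
  let ?n = "route_bound (f c) (lower_bound f c ss)"
  have c: "0 < f c" "f c < f u" using heavy_potential_pos[of f c ss] assms by auto
  have LB: "0 < lower_bound f c ss" using lower_bound_ge[of f c ss] assms c by auto
  show ?thesis
  proof (rule route_bound_eqI)
    show "lower_bound f u [Node c ss] \<le> 2 * f u * ?n"
      using le_route_bound[OF c(1), of "lower_bound f c ss"] by (simp add: algebra_simps)
    show "2 * f u * (real_of_int ?n - 1) < lower_bound f u [Node c ss]"
      using route_bound_less[OF c(1) LB] c(2) by (simp add: algebra_simps)
  qed (use c route_bound_ge_1 in auto)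
qed

lemma surplus_single:
  assumes "decreasing f u [Node c ss]" "f c < forest_weight f c ss"
  shows "surplus f u [Node c ss] = surplus f c ss"
  unfolding surplus_def route_bound_single[OF assms] by (simp add: algebra_simps)

lemma surplus_bounds:
  assumes "decreasing f u ts" "0 \<le> f u" "f u < forest_weight f u ts"
  shows "0 \<le> surplus f u ts" "surplus f u ts < 2 * f u"
proof -
  have u: "0 < f u" using heavy_potential_pos[of f u ts, OF assms] .
  show "0 \<le> surplus f u ts"
    using le_route_bound[OF u, of "lower_bound f u ts"] by (simp add: surplus_def)
  have "0 < lower_bound f u ts" using lower_bound_ge[OF assms(1)] assms u by auto
  from route_bound_less[of "f u", OF u this] show "surplus f u ts < 2 * f u"
    by (simp add: surplus_def algebra_simps)
qed

text \<open>A stop at \<open>u\<close> needs an entry slack below \<open>2 * (f u - f c)\<close>,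
  where the indicator at \<open>u\<close> is 0 because the surplus is below \<open>2 * f c\<close>.
  The subtree is then entered with full slack, so its own indicator is 1 and pays for the stop.
  Without a stop, both sides of the test shift equally.\<close>

lemma few_stops_single:
  assumes "decreasing f u [Node c ss]" "f c < forest_weight f c ss" "few_stops f c ss"
  shows "few_stops f u [Node c ss]"
  unfolding few_stops_def
proof (intro allI impI)
  fix g assume g: "0 \<le> g" "g \<le> 2 * f u"
  let ?n = "route_bound (f c) (lower_bound f c ss)" and ?d = "descend f u c g"
  have c: "0 < f c" "f c < f u" using heavy_potential_pos[of f c ss] assms by auto
  \<comment> \<open>The ratio of lower bound to potential is at most \<open>2 * ?n\<close> at
    \<open>c\<close>, and the edge contributes with ratio exactly \<open>2 * ?n\<close>, so the
    ratio does not drop towards \<open>u\<close>.\<close>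
  have "lower_bound f c ss * (f u - f c) \<le> 2 * f c * ?n * (f u - f c)"
    using le_route_bound[OF c(1), of "lower_bound f c ss"] c by (intro mult_right_mono) auto
  then have "lower_bound f c ss / f c \<le> lower_bound f u [Node c ss] / f u"
    using c by (simp add: field_simps)
  then have Q: "stop_bound f c ss \<le> stop_bound f u [Node c ss]"
    unfolding stop_bound_def route_bound_single[OF assms(1,2)] by simp
  have E: "0 \<le> surplus f c ss" "surplus f c ss < 2 * f c"
    using surplus_bounds[of f c ss] assms c by auto
  have d: "0 \<le> ?d" "?d \<le> 2 * f c" using descend_bounds[of f c g u] g c by auto
  have "length (stops f c ss ?d) + of_bool (2 * f c - surplus f c ss \<le> ?d) +
       of_bool (slack_out f c ss ?d < surplus f c ss) \<le> stop_bound f c ss"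
    using assms(3) d unfolding few_stops_def by blast
  moreover have "length (stops f u [Node c ss] g) =
      (if 2 * (f u - f c) \<le> g then 0 else 1) + length (stops f c ss ?d)"
    "slack_out f u [Node c ss] g = slack_out f c ss ?d"
    by simp_all
  moreover have "?d = (if 2 * (f u - f c) \<le> g then g - 2 * (f u - f c) else 2 * f c)"
    by (simp add: descend_def)
  ultimately show "length (stops f u [Node c ss] g) + of_bool (2 * f u - surplus f u [Node c ss] \<le> g) +
       of_bool (slack_out f u [Node c ss] g < surplus f u [Node c ss]) \<le> stop_bound f u [Node c ss]"
    using Q E g c unfolding surplus_single[OF assms(1,2)]
    by (cases "2 * (f u - f c) \<le> g"; cases "2 * f u - surplus f c ss \<le> g") simp_all
qed

text \<open>Amortisation with the slack as potential: a stop in a light tree of weight \<open>\<omega>\<close> needs an entry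
  slack below \<open>2 \<omega>\<close> and leaves a slack of at least \<open>2 \<phi>(u) - 2 \<omega>\<close>, whereas a heavy tree can change the
  slack arbitrarily, which is paid for by one extra stop.\<close>

definition stop_charge :: "('a \<Rightarrow> real) \<Rightarrow> 'a \<Rightarrow> 'a rose \<Rightarrow> real" where
  "stop_charge f u t = (if f u < forest_weight f u [t] then stop_bound f u [t] + 1
     else 2 * forest_weight f u [t] / f u)"

lemma stops_le_charges:
  assumes "decreasing f u ts" "0 < f u" "0 \<le> g" "g \<le> 2 * f u"
    and "\<And>t. t \<in> set ts \<Longrightarrow> f u < forest_weight f u [t] \<Longrightarrow> few_stops f u [t]"
  shows "2 * f u * length (stops f u ts g) + g \<le>
    2 * f u * (\<Sum>t\<leftarrow>ts. stop_charge f u t) + slack_out f u ts g"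
  using assms
proof (induction ts arbitrary: g)
  case (Cons t ts)
  let ?o = "slack_out f u [t] g"
  have dec: "decreasing f u [t]" "decreasing f u ts"
    using Cons.prems(1) decreasing_append[of f u "[t]" ts] by auto
  have o: "0 \<le> ?o" "?o \<le> 2 * f u"
    using slack_out_bounds[of f u "[t]" g, OF dec(1) Cons.prems(3,4)] by auto
  have IH: "2 * f u * length (stops f u ts ?o) + ?o \<le>
    2 * f u * (\<Sum>t\<leftarrow>ts. stop_charge f u t) + slack_out f u ts ?o"
    using Cons.IH[OF dec(2) Cons.prems(2) o] Cons.prems(5) by simp
  \<comment> \<open>The additional 1 in the charge of a heavy tree is worth \<open>2 * f u\<close>,
    the most by which the slack can drop.\<close>
  have hd: "2 * f u * length (stops f u [t] g) + g \<le> 2 * f u * stop_charge f u t + ?o"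
  proof (cases "f u < forest_weight f u [t]")
    case True
    then have "few_stops f u [t]" using Cons.prems(5) by simp
    then have "length (stops f u [t] g) \<le> stop_bound f u [t]"
      by (rule length_stops_le[of f u]) (use Cons.prems(3,4) in auto)
    then have "2 * f u * length (stops f u [t] g) \<le> 2 * f u * stop_bound f u [t]"
      using Cons.prems(2) by simp
    then show ?thesis using True o Cons.prems(4) by (simp add: stop_charge_def algebra_simps)
  next
    case False
    then have "if 2 * forest_weight f u [t] \<le> g
    then stops f u [t] g = [] \<and> ?o = g - 2 * forest_weight f u [t]
    else length (stops f u [t] g) = 1 \<and> 2 * f u - 2 * forest_weight f u [t] \<le> ?o"
      using light_run[of f u "[t]" g, OF dec(1) _ Cons.prems(3,4)] by auto
    then show ?thesis
      using False Cons.prems(2) forest_weight_nonneg[OF dec(1)]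
      by (auto simp: stop_charge_def split: if_splits)
  qed
  have "stops f u (t # ts) g = stops f u [t] g @ stops f u ts ?o"
    "slack_out f u (t # ts) g = slack_out f u ts ?o"
    using stops_append[of f u "[t]" ts g] slack_out_append[of f u "[t]" ts g] by auto
  then show ?case using IH hd by (simp add: algebra_simps)
qed simp

text \<open>The charge of a light tree is exactly its share of
  \<open>lower_bound f u ts / f u\<close>; that of a heavy tree with bound \<open>n\<close> exceeds
  its share by \<open>8 * n - 13 + 1 = 8 * (n - 1) - 4\<close>.\<close>

lemma sum_stop_charge:
  assumes "decreasing f u ts" "0 < f u"
  shows "(\<Sum>t\<leftarrow>ts. stop_charge f u t) = lower_bound f u ts / f u +
    (\<Sum>t\<leftarrow>filter (\<lambda>t. f u < forest_weight f u [t]) ts.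
       8 * real_of_int (route_bound (f u) (lower_bound f u [t]) - 1) - 4)"
  using assms
proof (induction ts)
  case (Cons t ts)
  have dec: "decreasing f u [t]" "decreasing f u ts"
    using Cons.prems(1) decreasing_append[of f u "[t]" ts] by auto
  have "lower_bound f u (t # ts) = lower_bound f u [t] + lower_bound f u ts"
    using lower_bound_append[of f u "[t]" ts] by simp
  then show ?case
    using Cons.IH[OF dec(2) Cons.prems(2)] light_lower_bound[of f u "[t]", OF dec(1)]
    by (auto simp: stop_charge_def stop_bound_def add_divide_distrib)
qed simp

text \<open>For a heavy tree, one route less than its bound has a budget below its lower bound.
  Summed up, this keeps the total of the \<open>n - 1\<close> below the bound of the whole
  forest.\<close>

lemma sum_heavy_route_bounds_less:
  assumes "decreasing f u ts" "0 < f u"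
  defines "hs \<equiv> filter (\<lambda>t. f u < forest_weight f u [t]) ts"
  assumes "hs \<noteq> []"
  shows "2 * f u * (\<Sum>t\<leftarrow>hs. real_of_int (route_bound (f u) (lower_bound f u [t]) - 1)) < lower_bound f u ts"
proof -
  \<comment> \<open>The weak inequality is carried along because the tail of the list may contain no
    heavy tree.\<close>
  have "2 * f u * (\<Sum>t\<leftarrow>hs. real_of_int (route_bound (f u) (lower_bound f u [t]) - 1)) \<le> lower_bound f u ts \<and>
    (hs \<noteq> [] \<longrightarrow>
      2 * f u * (\<Sum>t\<leftarrow>hs. real_of_int (route_bound (f u) (lower_bound f u [t]) - 1)) < lower_bound f u ts)"
    using assms(1,2) unfolding hs_def
  proof (induction ts)
    case (Cons t ts)
    have dec: "decreasing f u [t]" "decreasing f u ts"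
      using Cons.prems(1) decreasing_append[of f u "[t]" ts] by auto
    have split: "lower_bound f u (t # ts) = lower_bound f u [t] + lower_bound f u ts"
      using lower_bound_append[of f u "[t]" ts] by simp
    have ge: "2 * forest_weight f u [t] \<le> lower_bound f u [t]" "0 \<le> forest_weight f u [t]"
      using lower_bound_ge[of f u "[t]", OF dec(1)] forest_weight_nonneg[of f u "[t]", OF dec(1)] by auto
    show ?case
    proof (cases "f u < forest_weight f u [t]")
      case True
      then have "0 < lower_bound f u [t]" using ge Cons.prems(2) by linarith
      from route_bound_less[of "f u", OF Cons.prems(2) this] show ?thesis
        using Cons.IH[OF dec(2) Cons.prems(2)] True unfolding split by (simp add: algebra_simps)
    next
      case False
      then show ?thesis
        using Cons.IH[OF dec(2) Cons.prems(2)] ge unfolding split by auto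
    qed
  qed simp
  with assms(4) show ?thesis by simp
qed

text \<open>The critical case: the light trees around the only heavy tree do not force an additional
  route. Then a stop among them uses up a spare stop granted by the two indicators.\<close>

lemma few_stops_one_heavy:
  assumes dec: "decreasing f u (xs @ t # ys)" and u: "0 < f u"
    and heavy: "f u < forest_weight f u [t]" and few: "few_stops f u [t]"
    and same: "route_bound (f u) (lower_bound f u (xs @ t # ys)) = route_bound (f u) (lower_bound f u [t])"
  shows "few_stops f u (xs @ t # ys)"
  unfolding few_stops_def
proof (intro allI impI)
  fix g assume g: "0 \<le> g" "g \<le> 2 * f u"
  define ts where "ts = xs @ t # ys"
  define g1 where "g1 = slack_out f u xs g"
  define g2 where "g2 = slack_out f u [t] g1"
  define wx where "wx = forest_weight f u xs"
  define wy where "wy = forest_weight f u ys"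
  have decs: "decreasing f u xs" "decreasing f u [t]" "decreasing f u ys"
    using dec decreasing_append[of f u "[t]" ys] by auto
  have LB: "lower_bound f u ts = lower_bound f u xs + lower_bound f u [t] + lower_bound f u ys"
    using lower_bound_append[of f u "[t]" ys] by (simp add: ts_def)
  have nn: "0 \<le> wx" "0 \<le> wy" "2 * wx \<le> lower_bound f u xs" "2 * wy \<le> lower_bound f u ys"
    unfolding wx_def wy_def
    using decs lower_bound_ge[of f u xs] lower_bound_ge[of f u ys]
      forest_weight_nonneg[of f u xs] forest_weight_nonneg[of f u ys] by auto
  have E: "surplus f u ts = surplus f u [t] - lower_bound f u xs - lower_bound f u ys"
    unfolding surplus_def same[folded ts_def] by (simp add: LB)
  have E0: "0 \<le> surplus f u ts"
    using le_route_bound[OF u, of "lower_bound f u ts"] by (simp add: surplus_def)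
  have Et: "surplus f u [t] < 2 * f u"
    using surplus_bounds(2)[of f u "[t]"] decs(2) u heavy by auto
  \<comment> \<open>As the forest needs no additional route, \<open>xs\<close> and \<open>ys\<close>
    together fit into the surplus of \<open>t\<close>, which is below
    \<open>2 * f u\<close>.\<close>
  have light: "wx \<le> f u" "wy \<le> f u" using E E0 Et nn by linarith+
  have LBx: "lower_bound f u xs = 2 * wx" "lower_bound f u ys = 2 * wy"
    using light_lower_bound[of f u xs] light_lower_bound[of f u ys] decs light
    by (auto simp: wx_def wy_def)
  have g1: "0 \<le> g1" "g1 \<le> 2 * f u"
    unfolding g1_def using slack_out_bounds[of f u xs g] decs g by auto
  have g2: "0 \<le> g2" "g2 \<le> 2 * f u"
    unfolding g2_def using slack_out_bounds[of f u "[t]" g1] decs g1 by auto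
  define g3 where "g3 = slack_out f u ys g2"
  have X: "if 2 * wx \<le> g then stops f u xs g = [] \<and> g1 = g - 2 * wx
    else length (stops f u xs g) = 1 \<and> 2 * f u - 2 * wx \<le> g1"
    using light_run[of f u xs g] decs light g unfolding wx_def g1_def by blast
  have Y: "if 2 * wy \<le> g2 then stops f u ys g2 = [] \<and> g3 = g2 - 2 * wy
    else length (stops f u ys g2) = 1 \<and> 2 * f u - 2 * wy \<le> g3"
    using light_run[of f u ys g2] decs light g2 unfolding wy_def g3_def by blast
  have T: "length (stops f u [t] g1) + of_bool (2 * f u - surplus f u [t] \<le> g1) +
       of_bool (g2 < surplus f u [t]) \<le> stop_bound f u [t]"
    using few g1 unfolding few_stops_def g2_def by blast
  have "lower_bound f u [t] / f u \<le> lower_bound f u ts / f u"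
    using LB nn u by (simp add: divide_right_mono)
  then have Q: "stop_bound f u [t] \<le> stop_bound f u ts"
    unfolding stop_bound_def same[folded ts_def] by simp
  have st: "length (stops f u ts g) = length (stops f u xs g) + length (stops f u [t] g1) + length (stops f u ys g2)"
    "slack_out f u ts g = g3"
    using stops_append[of f u "[t]" ys g1] slack_out_append[of f u "[t]" ys g1]
    by (simp_all add: ts_def g1_def g2_def g3_def)
  \<comment> \<open>If \<open>xs\<close> forces a stop, \<open>t\<close> is entered with slack at
    least \<open>2 * f u - 2 * wx\<close>, so its entry indicator is 1, whereas
    \<open>g < 2 * wx\<close> makes that of the whole forest 0.\<close>
  have pre: "length (stops f u xs g) + of_bool (2 * f u - surplus f u ts \<le> g)
      \<le> (of_bool (2 * f u - surplus f u [t] \<le> g1) :: real)"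
    using X E E0 Et LBx nn by (cases "2 * wx \<le> g") auto
  \<comment> \<open>A stop in \<open>ys\<close> needs \<open>g2 < 2 * wy\<close>, so the exit
    indicator of \<open>t\<close> is 1; afterwards the slack is too large for that of the whole
    forest.\<close>
  have post: "length (stops f u ys g2) + of_bool (g3 < surplus f u ts)
      \<le> (of_bool (g2 < surplus f u [t]) :: real)"
    using Y E E0 Et LBx nn by (cases "2 * wy \<le> g2") auto
  show "length (stops f u (xs @ t # ys) g) + of_bool (2 * f u - surplus f u (xs @ t # ys) \<le> g) +
       of_bool (slack_out f u (xs @ t # ys) g < surplus f u (xs @ t # ys)) \<le> stop_bound f u (xs @ t # ys)"
    unfolding ts_def[symmetric] st using pre post T Q by simp
qed

text \<open>The charges suffice if there is no heavy tree, as \<open>N \<ge> 2\<close>; if there are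
  at least two, as \<open>K < N\<close> and each contributes \<open>- 4\<close>; and if there is one
  and \<open>K \<le> N - 2\<close>. What remains is one heavy tree whose bound equals that of the
  whole forest.\<close>

lemma few_stops_of_subtrees:
  assumes dec: "decreasing f u ts" and f: "0 \<le> f u" and heavy: "f u < forest_weight f u ts"
    and few: "\<And>t. t \<in> set ts \<Longrightarrow> f u < forest_weight f u [t] \<Longrightarrow> few_stops f u [t]"
  shows "few_stops f u ts"
proof -
  define n where "n t = route_bound (f u) (lower_bound f u [t])" for t
  define N where "N = route_bound (f u) (lower_bound f u ts)"
  define hs where "hs = filter (\<lambda>t. f u < forest_weight f u [t]) ts"
  define K where "K = (\<Sum>t\<leftarrow>hs. n t - 1)"
  have u: "0 < f u" using heavy_potential_pos[of f u ts] dec f heavy by auto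
  have N2: "2 \<le> N" unfolding N_def using heavy_route_bound[of f u ts] dec f heavy by auto
  have K_real: "(\<Sum>t\<leftarrow>hs. real_of_int (n t - 1)) = K"
    unfolding K_def by (induction hs) auto
  have KN: "K < N" if "hs \<noteq> []"
  proof -
    have "2 * f u * K < lower_bound f u ts"
      using sum_heavy_route_bounds_less[of f u ts] dec u that K_real
      unfolding hs_def n_def by auto
    also have "\<dots> \<le> 2 * f u * N" unfolding N_def by (rule le_route_bound[OF u])
    finally show ?thesis using u by simp
  qed
  have charge: "(\<Sum>t\<leftarrow>ts. stop_charge f u t) = lower_bound f u ts / f u + 8 * K - 4 * length hs"
  proof -
    have "(\<Sum>t\<leftarrow>hs. 8 * real_of_int (n t - 1) - 4) = 8 * K - 4 * length hs"
      unfolding K_def by (induction hs) (auto simp: algebra_simps)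
    with sum_stop_charge[of f u ts, OF dec u] show ?thesis
      unfolding hs_def n_def by simp
  qed
  show ?thesis
  \<comment> \<open>The condition says that the charges, 1 for the slack left at the end and 2 for
    the indicators fit into \<open>stop_bound\<close>.\<close>
  proof (cases "8 * K - 4 * int (length hs) + 16 \<le> 8 * N")
    case True
    show ?thesis unfolding few_stops_def
    proof (intro allI impI)
      fix g assume g: "0 \<le> g" "g \<le> 2 * f u"
      have "2 * f u * length (stops f u ts g) + g \<le>
        2 * f u * (\<Sum>t\<leftarrow>ts. stop_charge f u t) + slack_out f u ts g"
        by (rule stops_le_charges[of f u, OF dec u g few])
      then have "2 * f u * length (stops f u ts g) \<le> 2 * f u * ((\<Sum>t\<leftarrow>ts. stop_charge f u t) + 1)"
        using slack_out_bounds(2)[of f u ts g] dec g by (simp add: algebra_simps)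
      then have "length (stops f u ts g) \<le> (\<Sum>t\<leftarrow>ts. stop_charge f u t) + 1"
        using u by simp
      moreover have "real_of_int (8 * K - 4 * int (length hs) + 16) \<le> real_of_int (8 * N)"
        using True by (simp only: of_int_le_iff)
      ultimately have "length (stops f u ts g) + 2 \<le> stop_bound f u ts"
        unfolding charge stop_bound_def N_def[symmetric] by simp
      then show "length (stops f u ts g) + of_bool (2 * f u - surplus f u ts \<le> g) +
         of_bool (slack_out f u ts g < surplus f u ts) \<le> stop_bound f u ts"
        by (simp add: of_bool_def split: if_splits)
    qed
  next
    case False
    then have "hs \<noteq> []" using N2 by (auto simp: K_def)
    moreover from this have "int (length hs) < 2" using False KN by linarith
    ultimately have "length hs = 1" by (cases hs) auto
    then obtain t where t: "hs = [t]" by (auto simp: length_Suc_conv)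
    then have "n t = N" using False KN by (auto simp: K_def)
    obtain xs ys where ts: "ts = xs @ t # ys"
      using t unfolding hs_def filter_eq_Cons_iff by auto
    have ht: "t \<in> set ts" "f u < forest_weight f u [t]"
      using arg_cong[OF t, of set] unfolding hs_def by auto
    show ?thesis
      unfolding ts
      by (rule few_stops_one_heavy)
        (use dec u ht few[OF ht] \<open>n t = N\<close> in \<open>simp_all add: ts n_def N_def\<close>)
  qed
qed

text \<open>The induction is run on the statement for every single heavy tree of the forest;
  heaviness of \<open>[Node c ss]\<close> at \<open>u\<close> amounts to heaviness of
  \<open>ss\<close> at \<open>c\<close>.\<close>

lemma few_stops_heavy:
  assumes "decreasing f u ts" "0 \<le> f u" "f u < forest_weight f u ts"
  shows "few_stops f u ts"
proof -
  have "\<forall>t\<in>set ts. f u < forest_weight f u [t] \<longrightarrow> few_stops f u [t]"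
    using assms(1)
  proof (induction f u ts rule: forest_weight.induct)
    case (2 f u c ss ts)
    have dec: "0 \<le> f c" "decreasing f c ss" "decreasing f u ts" "decreasing f u [Node c ss]"
      using 2(3) by auto
    have "few_stops f u [Node c ss]" if "f u < forest_weight f u [Node c ss]"
    proof -
      from that have h: "f c < forest_weight f c ss" by simp
      then have "few_stops f c ss"
        using few_stops_of_subtrees[of f c ss] dec "2.IH"(1)[OF dec(2)] by blast
      then show ?thesis using few_stops_single[of f u c ss] dec h by blast
    qed
    then show ?case using "2.IH"(2)[OF dec(3)] by auto
  qed simp
  then show ?thesis using few_stops_of_subtrees[of f u ts] assms by blast
qed

text \<open>One bound for both cases: a light forest has at most one stop, and for a heavy one
  \<open>lower_bound f u ts / f u\<close> is at most twice the route bound.\<close>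

lemma length_stops_le_route_bound:
  assumes "decreasing f u ts" "0 \<le> g" "g \<le> 2 * f u"
  shows "length (stops f u ts g) \<le> 10 * real_of_int (route_bound (f u) (lower_bound f u ts)) - 9"
proof (cases "forest_weight f u ts \<le> f u")
  case True
  then have "length (stops f u ts g) \<le> 1"
    using light_run[of f u ts g] assms by (auto split: if_splits)
  then show ?thesis using route_bound_ge_1[of "f u" "lower_bound f u ts"] by linarith
next
  case False
  then have h: "0 \<le> f u" "f u < forest_weight f u ts" using assms by auto
  have u: "0 < f u" using heavy_potential_pos[of f u ts] assms h by auto
  have "lower_bound f u ts / f u \<le> 2 * route_bound (f u) (lower_bound f u ts)"
    using le_route_bound[OF u, of "lower_bound f u ts"] u by (simp add: field_simps)
  moreover have "length (stops f u ts g) \<le> stop_bound f u ts"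
    using length_stops_le[of f u ts g] few_stops_heavy[of f u ts] assms h by blast
  ultimately show ?thesis by (simp add: stop_bound_def)
qed

text \<open>An edge is paid once for each stop in the subtree below it, hence at most
  \<open>10 * n - 9\<close> times. It enters \<open>lower_bound\<close> with
  \<open>2 * (f u - f c) * n\<close> and \<open>forest_weight\<close> with \<open>f u - f c\<close>,
  which gives the factors 5 and 9.\<close>

lemma sum_stops_le:
  assumes "decreasing f u ts" "0 \<le> g" "g \<le> 2 * f u"
  shows "(\<Sum>s\<leftarrow>stops f u ts g. f u - f s) \<le> 5 * lower_bound f u ts - 9 * forest_weight f u ts"
  using assms
proof (induction f u ts g rule: stops.induct)
  case (2 f u c ss ts g)
  define d where "d = descend f u c g"
  define g1 where "g1 = slack_out f c ss d"
  define n where "n = real_of_int (route_bound (f c) (lower_bound f c ss))"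
  have dec: "0 \<le> f c" "f c < f u" "decreasing f c ss" "decreasing f u ts"
    using "2.prems"(1) by auto
  have d: "0 \<le> d" "d \<le> 2 * f c"
    unfolding d_def using descend_bounds[of f c g u] dec "2.prems" by auto
  have g1: "0 \<le> g1" "g1 \<le> 2 * f u"
    unfolding g1_def using slack_out_bounds[of f c ss d] dec d by auto
  have IH1: "(\<Sum>s\<leftarrow>stops f c ss d. f c - f s) \<le> 5 * lower_bound f c ss - 9 * forest_weight f c ss"
    using "2.IH"(1)[folded d_def] dec d by auto
  have IH2: "(\<Sum>s\<leftarrow>stops f u ts g1. f u - f s) \<le> 5 * lower_bound f u ts - 9 * forest_weight f u ts"
    using "2.IH"(2)[folded d_def, folded g1_def] dec g1 by auto
  have shift: "(\<Sum>s\<leftarrow>xs. f u - f s) = (\<Sum>s\<leftarrow>xs. f c - f s) + (f u - f c) * length xs" for xs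
    by (induction xs) (auto simp: algebra_simps)
  have "(f u - f c) * length (stops f c ss d) \<le> (f u - f c) * (10 * n - 9)"
    unfolding n_def using length_stops_le_route_bound[of f c ss d] dec d by (intro mult_left_mono) auto
  moreover have "(\<Sum>s\<leftarrow>stops f u (Node c ss # ts) g. f u - f s) =
      (\<Sum>s\<leftarrow>stops f c ss d. f u - f s) + (\<Sum>s\<leftarrow>stops f u ts g1. f u - f s)"
    by (simp add: d_def g1_def)
  ultimately show ?case
    using IH1 IH2 unfolding shift by (simp add: n_def algebra_simps)
qed simp

subsection \<open>Walks and paths in trees\<close>

lemma walk_Cons:
  "walk T (x # p) \<longleftrightarrow> x \<in> verts T \<and> (p = [] \<or> {x, hd p} \<in> edges T \<and> walk T p)"
  by (cases p) (auto simp: walk_def)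

lemma walk_append:
  assumes "p \<noteq> []" "q \<noteq> []"
  shows "walk T (p @ q) \<longleftrightarrow> walk T p \<and> walk T q \<and> {last p, hd q} \<in> edges T"
  using assms by (auto simp: walk_def successively_append_iff)

lemma walk_rev [simp]: "walk T (rev p) \<longleftrightarrow> walk T p"
  by (simp add: walk_def insert_commute)

lemma walk_snoc_Cons: "walk T (xs @ z # ys) \<longleftrightarrow> walk T (xs @ [z]) \<and> walk T (z # ys)"
  by (cases "xs = []"; cases "ys = []") (auto simp: walk_append walk_Cons)

lemma walk_betw_shorten:
  assumes "walk_betw T u p v"
  shows "\<exists>q. walk_betw T u q v \<and> distinct q"
  using assms
proof (induction "length p" arbitrary: p rule: less_induct)
  case less
  show ?case
  proof (cases "distinct p")
    case False
    then obtain xs ys zs y where p: "p = xs @ [y] @ ys @ [y] @ zs"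
      using not_distinct_decomp by blast
    have "walk T (xs @ y # (ys @ y # zs))" using less.prems unfolding p walk_betw_def by simp
    then have "walk T (xs @ [y])" "walk T ((y # ys) @ y # zs)"
      using walk_snoc_Cons[of T xs y "ys @ y # zs"] by auto
    then have "walk T (xs @ y # zs)"
      using walk_snoc_Cons[of T "y # ys" y zs] walk_snoc_Cons[of T xs y zs] by auto
    then have "walk_betw T u (xs @ y # zs) v"
      using less.prems unfolding p walk_betw_def by (cases xs) auto
    then show ?thesis using less.hyps[of "xs @ y # zs"] unfolding p by simp
  qed (use less.prems in blast)
qed

section \<open>Sums over consecutive vertices of a walk\<close>

fun pair_sum :: "('a \<Rightarrow> 'a \<Rightarrow> real) \<Rightarrow> 'a list \<Rightarrow> real" where
  "pair_sum h (x # y # p) = h x y + pair_sum h (y # p)"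
| "pair_sum h _ = 0"

lemma len_eq_pair_sum: "len T p = pair_sum (\<lambda>x y. weight T {x, y}) p"
  by (induction p rule: induct_list012) auto

lemma pair_sum_split: "pair_sum h (xs @ v # ys) = pair_sum h (xs @ [v]) + pair_sum h (v # ys)"
proof (induction xs)
  case (Cons x xs)
  then show ?case by (cases xs) auto
qed simp

lemma pair_sum_mono:
  assumes "walk T p" "\<And>x y. {x, y} \<in> edges T \<Longrightarrow> h x y \<le> h' x y"
  shows "pair_sum h p \<le> pair_sum h' p"
  using assms by (induction p rule: induct_list012) (auto simp: walk_Cons intro!: add_mono)

lemma pair_sum_nonneg:
  assumes "walk T p" "\<And>x y. {x, y} \<in> edges T \<Longrightarrow> 0 \<le> h x y"
  shows "0 \<le> pair_sum h p"
  using assms by (induction p rule: induct_list012) (auto simp: walk_Cons)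

lemma pair_sum_add: "pair_sum (\<lambda>x y. h x y + h' x y) p = pair_sum h p + pair_sum h' p"
  by (induction p rule: induct_list012) auto

lemma pair_sum_sum: "pair_sum (\<lambda>x y. \<Sum>c\<in>A. h c x y) p = (\<Sum>c\<in>A. pair_sum (h c) p)"
  by (induction p rule: induct_list012) (auto simp: sum.distrib)

lemma variation_ge: "p \<noteq> [] \<Longrightarrow> \<bar>h (hd p) - h (last p)\<bar> \<le> pair_sum (\<lambda>x y. \<bar>h x - h y :: real\<bar>) p"
  by (induction p rule: induct_list012) (auto split: if_splits)

text \<open>The walk must lead from \<open>h r\<close> to \<open>h v\<close> and back. It is applied
  to a truncated depth, for the part of a route outside a subtree, and to a scaled indicator, for
  the crossings of an edge.\<close>

lemma closed_variation_ge:
  assumes "walk_betw T r p r" "v \<in> set p"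
  shows "2 * \<bar>h v - h r\<bar> \<le> pair_sum (\<lambda>x y. \<bar>h x - h y :: real\<bar>) p"
proof -
  obtain xs ys where p: "p = xs @ v # ys" using assms(2) split_list by metis
  have "hd (xs @ [v]) = r" "last (v # ys) = r"
    using assms(1) unfolding p walk_betw_def by (cases xs; auto)+
  then show ?thesis
    using variation_ge[of "xs @ [v]" h] variation_ge[of "v # ys" h] abs_minus_commute[of "h r" "h v"]
    unfolding p by (subst pair_sum_split) simp
qed

lemma len_append:
  assumes "p \<noteq> []" "q \<noteq> []" "last p = hd q"
  shows "len T (p @ tl q) = len T p + len T q"
proof -
  obtain xs v where p: "p = xs @ [v]" using assms(1) by (metis append_butlast_last_id)
  obtain ys where q: "q = v # ys" using assms(2,3) p by (cases q) auto
  show ?thesis unfolding len_eq_pair_sum p q using pair_sum_split[of _ xs v ys] by simp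
qed

lemma len_snoc: "p \<noteq> [] \<Longrightarrow> len T (p @ [z]) = len T p + weight T {last p, z}"
  using len_append[of p "[last p, z]" T] by simp

lemma len_rev: "len T (rev p) = len T p"
proof (induction p)
  case (Cons x p)
  then show ?case
    using len_snoc[of "rev p" T x] by (cases p) (auto simp: insert_commute)
qed simp

section \<open>Unique paths, parents and descendants\<close>

locale rooted_tree =
  fixes T :: "'a wtree"
  assumes tree: "weighted_rooted_tree T"
begin

lemma root_in_verts: "root T \<in> verts T"
  using tree by (simp add: weighted_rooted_tree_def)

lemma finite_verts: "finite (verts T)"
  using tree by (simp add: weighted_rooted_tree_def)

lemma edgeD: "{x, y} \<in> edges T \<Longrightarrow> x \<in> verts T \<and> y \<in> verts T \<and> x \<noteq> y \<and> 0 < weight T {x, y}"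
  using tree by (auto simp: weighted_rooted_tree_def doubleton_eq_iff subset_iff)

lemma edgeE:
  assumes "e \<in> edges T"
  obtains x y where "e = {x, y}" "{x, y} \<in> edges T"
  using assms tree unfolding weighted_rooted_tree_def by blast

text \<open>Common initial vertices are stripped by induction. Where two simple walks part, the
  first vertex of one that lies on the other closes a cycle.\<close>

lemma simple_walk_unique:
  assumes "walk_betw T u p v" "distinct p" "walk_betw T u q v" "distinct q"
  shows "p = q"
  using assms
proof (induction p arbitrary: u q)
  case Nil
  then show ?case by (simp add: walk_betw_def walk_def)
next
  case (Cons x p')
  have x: "x = u" using Cons.prems(1) by (simp add: walk_betw_def)
  obtain q' where q: "q = u # q'"
    using Cons.prems(3) by (cases q) (auto simp: walk_betw_def walk_def)
  show ?case
  proof (cases "p' = [] \<or> q' = []")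
    case True
    then have "v = u" using Cons.prems x q by (auto simp: walk_betw_def)
    then have "p' = []" "q' = []"
      using Cons.prems x q last_in_set[of p'] last_in_set[of q']
      by (auto simp: walk_betw_def split: if_splits)
    then show ?thesis using x q by simp
  next
    case False
    then have wp: "walk T p'" "last p' = v" "{u, hd p'} \<in> edges T"
      and wq: "walk T q'" "last q' = v" "{u, hd q'} \<in> edges T"
      and u: "u \<in> verts T" "u \<notin> set p'" "u \<notin> set q'" "distinct p'" "distinct q'"
      using Cons.prems x q by (auto simp: walk_betw_def walk_Cons)
    show ?thesis
    proof (cases "hd p' = hd q'")
      case True
      then have "p' = q'"
        using Cons.IH[of "hd p'" q'] wp wq u by (simp add: walk_betw_def)
      then show ?thesis using x q by simp
    next
      case neq: False
      have "\<exists>z\<in>set p'. z \<in> set q'"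
        using last_in_set[of p'] last_in_set[of q'] False wp(2) wq(2) by auto
      \<comment> \<open>Taking the first common vertex keeps \<open>a\<close> disjoint from
        \<open>b\<close>; as the heads differ, \<open>a\<close> or \<open>b\<close> is nonempty, so
        the cycle has length at least 3.\<close>
      then obtain a z b' where p': "p' = a @ z # b'" and z: "z \<in> set q'" and a: "\<forall>y\<in>set a. y \<notin> set q'"
        using split_list_first_prop[of p' "\<lambda>z. z \<in> set q'"] by blast
      obtain b c where q': "q' = b @ z # c" using z split_list by metis
      have "walk T (a @ [z])" "walk T (b @ [z])"
        using wp(1) wq(1) walk_snoc_Cons[of T a z b'] walk_snoc_Cons[of T b z c] p' q' by auto
      moreover from this have "walk T (z # rev b)" using walk_rev[of T "b @ [z]"] by simp
      ultimately have "walk T (a @ z # rev b)" using walk_snoc_Cons[of T a z "rev b"] by auto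
      moreover have "hd (a @ z # rev b) = hd p'" unfolding p' by (cases a) auto
      ultimately have "walk T (u # a @ z # rev b)" using wp(3) u(1) by (simp add: walk_Cons)
      moreover have "last (u # a @ z # rev b) = hd q'" unfolding q' by (cases b) auto
      moreover have "distinct (u # a @ z # rev b)" using u a unfolding p' q' by auto
      moreover have "length (u # a @ z # rev b) \<ge> 3"
        using neq unfolding p' q' by (cases a; cases b) auto
      ultimately have "cycle T (u # a @ z # rev b)"
        using wq(3) by (simp add: cycle_def insert_commute)
      then show ?thesis using tree by (auto simp: weighted_rooted_tree_def)
    qed
  qed
qed

lemma tree_path_eqI: "walk_betw T u p v \<Longrightarrow> distinct p \<Longrightarrow> tree_path T u v = p"
  unfolding tree_path_def using simple_walk_unique by (intro the_equality) auto

lemma tree_path: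
  assumes "u \<in> verts T" "v \<in> verts T"
  shows "walk_betw T u (tree_path T u v) v" "distinct (tree_path T u v)"
proof -
  obtain p where "walk_betw T u p v" using assms tree unfolding weighted_rooted_tree_def by blast
  then obtain q where "walk_betw T u q v" "distinct q" using walk_betw_shorten by metis
  then show "walk_betw T u (tree_path T u v) v" "distinct (tree_path T u v)"
    using tree_path_eqI by auto
qed

abbreviation rpath :: "'a \<Rightarrow> 'a list" where "rpath v \<equiv> tree_path T (root T) v"

abbreviation depth :: "'a \<Rightarrow> real" where "depth v \<equiv> tdist T (root T) v"

lemma rpath:
  assumes "v \<in> verts T"
  shows "rpath v \<noteq> []" "walk T (rpath v)" "hd (rpath v) = root T" "last (rpath v) = v"
    "distinct (rpath v)" "v \<in> set (rpath v)"
proof -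
  show *: "rpath v \<noteq> []" "walk T (rpath v)" "hd (rpath v) = root T" "last (rpath v) = v"
    "distinct (rpath v)"
    using tree_path[OF root_in_verts assms] by (auto simp: walk_betw_def walk_def)
  show "v \<in> set (rpath v)" using *(1,4) last_in_set by metis
qed

lemma rpath_root: "rpath (root T) = [root T]"
  using root_in_verts by (intro tree_path_eqI) (auto simp: walk_betw_def walk_def)

lemma depth_root: "depth (root T) = 0"
  by (simp add: tdist_def rpath_root)

lemma tree_path_rev:
  assumes "u \<in> verts T" "v \<in> verts T"
  shows "tree_path T v u = rev (tree_path T u v)"
  using tree_path[OF assms]
  by (intro tree_path_eqI) (auto simp: walk_betw_def walk_def hd_rev last_rev insert_commute)

lemma tdist_commute: "u \<in> verts T \<Longrightarrow> v \<in> verts T \<Longrightarrow> tdist T v u = tdist T u v"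
  using tree_path_rev[of u v] by (simp add: tdist_def len_rev)

lemma rpath_prefix:
  assumes "y \<in> verts T" "rpath y = xs @ c # zs"
  shows "rpath c = xs @ [c]"
proof (rule tree_path_eqI)
  show "walk_betw T (root T) (xs @ [c]) c"
    using rpath[OF assms(1)] assms(2) walk_snoc_Cons[of T xs c zs]
    by (cases xs) (auto simp: walk_betw_def)
  show "distinct (xs @ [c])" using rpath(5)[OF assms(1)] assms(2) by simp
qed

lemma childrenD:
  assumes "z \<in> children T y"
  shows "{y, z} \<in> edges T" "y \<in> verts T" "z \<in> verts T" "rpath z = rpath y @ [z]"
proof -
  show e: "{y, z} \<in> edges T" using assms by (auto simp: children_def)
  then show y: "y \<in> verts T" and z: "z \<in> verts T" using edgeD by blast+
  obtain xs zs where p: "rpath z = xs @ y # zs"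
    using assms split_list[of y "rpath z"] by (auto simp: children_def)
  \<comment> \<open>The rest of \<open>rpath z\<close> from \<open>y\<close> on and the single edge
    are both simple walks from \<open>y\<close> to \<open>z\<close>.\<close>
  have "y # zs = [y, z]"
  proof (rule simple_walk_unique)
    show "walk_betw T y (y # zs) z"
      using rpath[OF z] walk_snoc_Cons[of T xs y zs] unfolding p by (simp add: walk_betw_def)
    show "distinct (y # zs)" using rpath(5)[OF z] unfolding p by simp
    show "walk_betw T y [y, z] z" using e y z by (simp add: walk_betw_def walk_def)
    show "distinct [y, z]" using edgeD[OF e] by simp
  qed
  then show "rpath z = rpath y @ [z]" using p rpath_prefix[OF z p] by simp
qed

lemma edge_children:
  assumes "{x, y} \<in> edges T"
  shows "y \<in> children T x \<or> x \<in> children T y"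
proof (cases "y \<in> set (rpath x)")
  case True
  then show ?thesis using assms edgeD[OF assms] by (auto simp: children_def insert_commute)
next
  case False
  have v: "x \<in> verts T" "y \<in> verts T" using edgeD[OF assms] by auto
  have "rpath y = rpath x @ [y]"
  proof (rule tree_path_eqI)
    show "walk_betw T (root T) (rpath x @ [y]) y"
      using rpath[OF v(1)] v(2) assms by (simp add: walk_betw_def walk_append walk_Cons)
    show "distinct (rpath x @ [y])" using rpath[OF v(1)] False by simp
  qed
  then show ?thesis using assms v rpath(6)[OF v(1)] by (auto simp: children_def)
qed

lemma parent_exists:
  assumes "v \<in> verts T" "v \<noteq> root T"
  shows "\<exists>x. v \<in> children T x"
proof -
  obtain xs where xs: "rpath v = xs @ [v]"
    using rpath(1,4)[OF assms(1)] by (metis append_butlast_last_id)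
  have "xs \<noteq> []" using xs rpath(3)[OF assms(1)] assms(2) by auto
  then have "{last xs, v} \<in> edges T" "last xs \<in> set (rpath v)"
    using rpath(2)[OF assms(1)] by (auto simp: xs walk_append)
  then show ?thesis using assms(1) by (auto simp: children_def)
qed

lemma depth_child: "z \<in> children T y \<Longrightarrow> depth z = depth y + weight T {y, z}"
  using childrenD[of z y] rpath[of y] by (simp add: tdist_def len_snoc)

lemma parent_unique: "z \<in> children T x \<Longrightarrow> z \<in> children T y \<Longrightarrow> x = y"
  using childrenD[of z x] childrenD[of z y] rpath(4)[of x] rpath(4)[of y] by simp

lemma root_not_child: "root T \<notin> children T x"
  using childrenD[of "root T" x] rpath(1)[of x] rpath_root by auto

lemma self_descendant: "c \<in> verts T \<Longrightarrow> c \<in> descendants T c"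
  using rpath(6) by (simp add: descendants_def)

lemma descendants_child:
  assumes "z \<in> children T y"
  shows "z \<in> descendants T c \<longleftrightarrow> z = c \<or> y \<in> descendants T c"
  using childrenD[OF assms] by (auto simp: descendants_def)

lemma root_descendant: "root T \<in> descendants T c \<Longrightarrow> c = root T"
  by (simp add: descendants_def rpath_root)

lemma descendants_disjoint:
  assumes "c \<in> children T u" "c' \<in> children T u" "y \<in> descendants T c" "y \<in> descendants T c'"
  shows "c = c'"
proof -
  have y: "y \<in> verts T" using assms(3) by (simp add: descendants_def)
  obtain xs zs xs' zs' where p: "rpath y = xs @ c # zs" "rpath y = xs' @ c' # zs'"
    using assms(3,4) split_list[of _ "rpath y"] unfolding descendants_def by blast
  have "xs @ [c] = rpath u @ [c]" "xs' @ [c'] = rpath u @ [c']"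
    using rpath_prefix[OF y p(1)] rpath_prefix[OF y p(2)] childrenD(4)[OF assms(1)]
      childrenD(4)[OF assms(2)] by simp_all
  then show ?thesis using p by simp
qed

lemma descendants_mono:
  assumes "c \<in> children T u"
  shows "descendants T c \<subseteq> descendants T u"
proof
  fix y assume "y \<in> descendants T c"
  then have y: "y \<in> verts T" "c \<in> set (rpath y)" by (auto simp: descendants_def)
  then obtain xs zs where p: "rpath y = xs @ c # zs" using split_list by metis
  have "xs = rpath u" using rpath_prefix[OF y(1) p] childrenD(4)[OF assms] by simp
  then show "y \<in> descendants T u"
    using p y(1) rpath(6)[OF childrenD(2)[OF assms]] by (simp add: descendants_def)
qed

lemma parent_not_descendant:
  assumes "c \<in> children T u"
  shows "u \<notin> descendants T c"
  using childrenD[OF assms] rpath(5)[of c] by (auto simp: descendants_def)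

text \<open>Along a parent-child edge, membership in \<open>descendants T c\<close> changes only if
  the child is \<open>c\<close>: the edge above \<open>c\<close> is the only gate to the
  subtree.\<close>

lemma leaving_edge:
  assumes "c \<in> children T u" "{x, y} \<in> edges T" "x \<in> descendants T c" "y \<notin> descendants T c"
  shows "x = c" "y = u"
proof -
  have "x \<in> children T y"
    using edge_children[OF assms(2)] descendants_child[of y x c] assms(3,4) by auto
  then show "x = c" using descendants_child[of x y c] assms(3,4) by auto
  with \<open>x \<in> children T y\<close> show "y = u" using parent_unique assms(1) by blast
qed

end

subsection \<open>The lower bound for exploration strategies\<close>

text \<open>This local condition suffices for weights, lengths and walks; the full condition
  \<open>ordered_subtree\<close> serves for the comparison with \<open>omega\<close> and with
  exploration strategies.\<close>

fun subforest :: "'a wtree \<Rightarrow> 'a \<Rightarrow> 'a rose list \<Rightarrow> bool" where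
  "subforest T u [] \<longleftrightarrow> True"
| "subforest T u (Node c ss # ts) \<longleftrightarrow> c \<in> children T u \<and> subforest T c ss \<and> subforest T u ts"

fun ordered_subtree :: "'a wtree \<Rightarrow> 'a rose \<Rightarrow> bool" where
  "ordered_subtree T (Node u ts) \<longleftrightarrow>
     distinct (map label ts) \<and> set (map label ts) = children T u \<and> (\<forall>t\<in>set ts. ordered_subtree T t)"

lemma subforest_iff: "subforest T u ts \<longleftrightarrow> (\<forall>t\<in>set ts. label t \<in> children T u \<and> subforest T (label t) (kids t))"
proof (induction ts)
  case (Cons t ts)
  then show ?case by (cases t) auto
qed simp

lemma ordered_subtree_subforest: "ordered_subtree T t \<Longrightarrow> subforest T (label t) (kids t)"
proof (induction t)
  case (Node u ts)
  then show ?case unfolding subforest_iff[of T "label (Node u ts)"] by auto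
qed

fun forest_edges :: "'a \<Rightarrow> 'a rose list \<Rightarrow> 'a set list" where
  "forest_edges u [] = []"
| "forest_edges u (Node c ss # ts) = {u, c} # forest_edges c ss @ forest_edges u ts"

lemma set_forest_edges:
  "set (forest_edges u ts) =
     (\<Union>t\<in>set ts. insert {u, label t} (set (forest_edges (label t) (kids t))))"
proof (induction ts)
  case (Cons t ts)
  then show ?case by (cases t) auto
qed simp

lemma forest_edges_complete:
  assumes "ordered_subtree T t" "x \<in> labels t" "y \<in> children T x"
  shows "y \<in> labels t \<and> {x, y} \<in> set (forest_edges (label t) (kids t))"
  using assms
proof (induction t)
  case (Node u ts)
  show ?case
  proof (cases "x = u")
    case True
    then have "y \<in> label ` set ts" using Node.prems by simp
    then obtain t where t: "t \<in> set ts" "label t = y" by blast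
    then have "y \<in> labels t" using rose.set_sel(1)[of t] by simp
    with t True show ?thesis by (auto simp: set_forest_edges[of u ts])
  next
    case False
    then obtain t where t: "t \<in> set ts" "x \<in> labels t" using Node.prems by auto
    then have "y \<in> labels t \<and> {x, y} \<in> set (forest_edges (label t) (kids t))"
      using Node.IH[OF t(1)] Node.prems by auto
    with t show ?thesis by (auto simp: set_forest_edges[of u ts])
  qed
qed

lemma sum_le_sum_list:
  assumes "A \<subseteq> set xs" "\<And>x. x \<in> set xs \<Longrightarrow> 0 \<le> (h x :: real)"
  shows "sum h A \<le> (\<Sum>x\<leftarrow>xs. h x)"
proof -
  have "sum h A \<le> sum h (set xs)" using assms by (intro sum_mono2) auto
  also have "\<dots> \<le> (\<Sum>x\<leftarrow>xs. h x)"
    using assms(2)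
  proof (induction xs)
    case (Cons x xs)
    then show ?case by (cases "x \<in> set xs") (auto simp: insert_absorb add_increasing)
  qed simp
  finally show ?thesis .
qed

lemma sum_list_sum_swap: "(\<Sum>x\<leftarrow>xs. \<Sum>a\<in>A. h a x) = (\<Sum>a\<in>A. \<Sum>x\<leftarrow>xs. h a x :: real)"
  by (induction xs) (auto simp: sum.distrib)

lemma pair_sum_eq_0: "(\<And>x y. x \<in> set p \<Longrightarrow> h x y = 0) \<Longrightarrow> pair_sum h p = 0"
  by (induction p rule: induct_list012) auto

section \<open>Splitting the length of a route along the subtrees\<close>

definition inside :: "'a wtree \<Rightarrow> 'a \<Rightarrow> 'a \<Rightarrow> 'a \<Rightarrow> real" where
  "inside T c x y = (if x \<in> descendants T c \<and> y \<in> descendants T c then weight T {x, y} else 0)"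

definition crossing :: "'a wtree \<Rightarrow> 'a \<Rightarrow> 'a \<Rightarrow> 'a \<Rightarrow> 'a \<Rightarrow> real" where
  "crossing T u c x y = (if {x, y} = {u, c} then weight T {x, y} else 0)"

context rooted_tree
begin

lemma potential_child:
  "c \<in> children T u \<Longrightarrow> potential T B u - potential T B c = weight T {u, c}"
  by (simp add: potential_def depth_child)

lemma weight_child_pos: "c \<in> children T u \<Longrightarrow> 0 < weight T {u, c}"
  using childrenD(1) edgeD by blast

lemma decreasing_potential:
  assumes "\<forall>v\<in>verts T. 0 \<le> potential T B v"
  shows "subforest T u ts \<Longrightarrow> decreasing (potential T B) u ts"
proof (induction u ts rule: forest_edges.induct)
  case (2 u c ss ts)
  then have c: "c \<in> children T u" by simp
  have "0 < potential T B u - potential T B c"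
    unfolding potential_child[OF c] by (rule weight_child_pos[OF c])
  with 2 assms childrenD(3)[OF c] show ?case by simp
qed simp

lemma forest_weight_eq:
  "subforest T u ts \<Longrightarrow> forest_weight (potential T B) u ts = (\<Sum>e\<leftarrow>forest_edges u ts. weight T e)"
  by (induction u ts rule: forest_edges.induct) (auto simp: potential_child)

lemma forest_edges_sound: "subforest T u ts \<Longrightarrow> set (forest_edges u ts) \<subseteq> edges T"
  by (induction u ts rule: forest_edges.induct) (auto dest: childrenD(1))

lemma verts_labels:
  assumes "ordered_subtree T t" "label t = root T" "v \<in> verts T"
  shows "v \<in> labels t"
  using assms(3)
proof (induction "length (rpath v)" arbitrary: v rule: less_induct)
  case less
  show ?case
  proof (cases "v = root T")
    case True
    then show ?thesis using assms(2) by (cases t) auto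
  next
    case False
    then obtain x where x: "v \<in> children T x" using parent_exists less.prems by blast
    then have "x \<in> labels t" using less.hyps[of x] childrenD[OF x] by simp
    then show ?thesis using forest_edges_complete[OF assms(1) _ x] by simp
  qed
qed

text \<open>Every edge joins a parent and a child and is therefore listed. An inequality in this
  direction tolerates repetitions in the list.\<close>

lemma omega_le_forest_weight:
  assumes "ordered_subtree T (Node (root T) ts)"
  shows "omega T \<le> forest_weight (potential T B) (root T) ts"
proof -
  have sub: "subforest T (root T) ts" using ordered_subtree_subforest[OF assms] by simp
  have "edges T \<subseteq> set (forest_edges (root T) ts)"
  proof
    fix e assume e: "e \<in> edges T"
    obtain x y where xy: "e = {x, y}" "{x, y} \<in> edges T" using edgeE[OF e] .
    have compl: "{a, b} \<in> set (forest_edges (root T) ts)" if "b \<in> children T a" for a b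
      using forest_edges_complete[OF assms verts_labels[OF assms] that] childrenD(2)[OF that] by simp
    show "e \<in> set (forest_edges (root T) ts)"
      using edge_children[OF xy(2)] compl[of y x] compl[of x y] xy(1) by (auto simp: insert_commute)
  qed
  moreover have "0 \<le> weight T e" if "e \<in> set (forest_edges (root T) ts)" for e
    using forest_edges_sound[OF sub] that tree unfolding weighted_rooted_tree_def
    by (meson less_imp_le subsetD)
  ultimately show ?thesis
    unfolding omega_def forest_weight_eq[OF sub] by (rule sum_le_sum_list)
qed

text \<open>Freezing the depth below \<open>c\<close> makes the part of the walk inside the subtree invisible, so
  that the rest still has to reach \<open>c\<close> and return.\<close>

lemma inside_le:
  assumes "c \<in> verts T" "route T R" "v \<in> set R" "v \<in> descendants T c"
  shows "pair_sum (inside T c) R + 2 * depth c \<le> len T R"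
proof -
  define h where "h x = (if x \<in> descendants T c then depth c else depth x)" for x
  have R: "walk T R" "walk_betw T (root T) R (root T)"
    using assms(2) by (auto simp: route_def walk_betw_def)
  \<comment> \<open>Below \<open>c\<close> the whole weight is inside and \<open>h\<close> is
    constant; on any other edge, including the one above \<open>c\<close>, nothing is inside and
    \<open>h\<close> changes by the weight.\<close>
  have h_child: "inside T c x y + \<bar>h x - h y\<bar> \<le> weight T {x, y}" if "y \<in> children T x" for x y
    using weight_child_pos[OF that] descendants_child[OF that, of c] depth_child[OF that]
      self_descendant[OF assms(1)]
    by (auto simp: h_def inside_def)
  have "inside T c x y + \<bar>h x - h y\<bar> \<le> weight T {x, y}" if "{x, y} \<in> edges T" for x y
    using edge_children[OF that]
  proof
    assume "x \<in> children T y"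
    then have "inside T c y x + \<bar>h y - h x\<bar> \<le> weight T {y, x}" by (rule h_child)
    moreover have "inside T c y x = inside T c x y" "weight T {y, x} = weight T {x, y}"
      by (auto simp: inside_def insert_commute)
    ultimately show ?thesis by linarith
  qed (rule h_child)
  then have "pair_sum (\<lambda>x y. inside T c x y + \<bar>h x - h y\<bar>) R \<le> len T R"
    unfolding len_eq_pair_sum by (rule pair_sum_mono[OF R(1)])
  moreover have "2 * \<bar>h v - h (root T)\<bar> \<le> pair_sum (\<lambda>x y. \<bar>h x - h y\<bar>) R"
    by (rule closed_variation_ge[OF R(2) assms(3)])
  moreover have "h v = depth c" "h (root T) = 0"
    using assms(4) root_descendant[of c] depth_root by (auto simp: h_def)
  ultimately show ?thesis unfolding pair_sum_add by auto
qed

text \<open>The indicator of the subtree, scaled by the edge weight, varies only on the edge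
  \<open>{u, c}\<close>, and a route starts and ends outside the subtree.\<close>

lemma crossing_ge:
  assumes "c \<in> children T u" "route T R" "v \<in> set R" "v \<in> descendants T c"
  shows "2 * weight T {u, c} \<le> pair_sum (crossing T u c) R"
proof -
  define h where "h x = (if x \<in> descendants T c then weight T {u, c} else 0)" for x
  have w: "0 < weight T {u, c}" by (rule weight_child_pos[OF assms(1)])
  have R: "walk T R" "walk_betw T (root T) R (root T)"
    using assms(2) by (auto simp: route_def walk_betw_def)
  have "\<bar>h x - h y\<bar> \<le> crossing T u c x y" if e: "{x, y} \<in> edges T" for x y
  proof -
    have e': "{y, x} \<in> edges T" using e by (simp add: insert_commute)
    show ?thesis
      using leaving_edge[OF assms(1) e] leaving_edge[OF assms(1) e'] edgeD[OF e] w
      by (auto simp: h_def crossing_def insert_commute)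
  qed
  then have "pair_sum (\<lambda>x y. \<bar>h x - h y\<bar>) R \<le> pair_sum (crossing T u c) R"
    by (rule pair_sum_mono[OF R(1)])
  moreover have "2 * \<bar>h v - h (root T)\<bar> \<le> pair_sum (\<lambda>x y. \<bar>h x - h y\<bar>) R"
    by (rule closed_variation_ge[OF R(2) assms(3)])
  moreover have "h v = weight T {u, c}" "h (root T) = 0"
    using assms(1,4) root_descendant[of c] root_not_child by (auto simp: h_def)
  ultimately show ?thesis using w by simp
qed

text \<open>Let \<open>k\<close> routes meet the subtree of \<open>c\<close>. Each spends at most
  \<open>2 * potential T B c\<close> inside, so \<open>k\<close> is at least the route bound at
  \<open>c\<close>; and each crosses \<open>{u, c}\<close> at least twice.\<close>

lemma edge_lower_bound_le:
  assumes C: "exploration_strategy T B C" and pot: "0 \<le> potential T B c"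
    and c: "c \<in> children T u"
    and LB: "lower_bound (potential T B) c ss \<le> (\<Sum>R\<leftarrow>C. pair_sum (inside T c) R)"
  shows "lower_bound (potential T B) u [Node c ss] \<le>
    (\<Sum>R\<leftarrow>C. pair_sum (\<lambda>x y. inside T c x y + crossing T u c x y) R)"
proof -
  let ?f = "potential T B"
  define meets where "meets R \<longleftrightarrow> set R \<inter> descendants T c \<noteq> {}" for R
  define k where "k = length (filter meets C)"
  have cv: "c \<in> verts T" by (rule childrenD(3)[OF c])
  have routes: "route T R" "len T R \<le> B" "walk T R" if "R \<in> set C" for R
    using C that by (auto simp: exploration_strategy_def route_def walk_betw_def)
  have "(\<Sum>R\<leftarrow>xs. pair_sum (inside T c) R) \<le> 2 * ?f c * length (filter meets xs)"
    if "set xs \<subseteq> set C" for xs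
    using that
  proof (induction xs)
    case (Cons R xs)
    then have R: "R \<in> set C" by simp
    have "pair_sum (inside T c) R \<le> (if meets R then 2 * ?f c else 0)"
    proof (cases "meets R")
      case True
      then obtain v where v: "v \<in> set R" "v \<in> descendants T c" by (auto simp: meets_def)
      from inside_le[OF cv routes(1)[OF R] v] routes(2)[OF R] True show ?thesis
        by (simp add: potential_def)
    next
      case False
      then have "pair_sum (inside T c) R = 0"
        by (intro pair_sum_eq_0) (auto simp: meets_def inside_def)
      with False show ?thesis by simp
    qed
    with Cons show ?case by (auto simp: algebra_simps)
  qed simp
  from this[of C] LB have LBk: "lower_bound ?f c ss \<le> 2 * ?f c * k" by (simp add: k_def)
  have k1: "1 \<le> k"
  proof -
    obtain R where "R \<in> set C" "c \<in> set R" using C cv by (auto simp: exploration_strategy_def)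
    then have "R \<in> set (filter meets C)" using self_descendant[OF cv] by (auto simp: meets_def)
    then show ?thesis unfolding k_def by (cases "filter meets C") auto
  qed
  have rb: "route_bound (?f c) (lower_bound ?f c ss) \<le> int k"
  proof (cases "?f c = 0")
    case True
    then show ?thesis using k1 by (simp add: route_bound_def)
  next
    case False
    then show ?thesis using k1 LBk pot by (subst route_bound_le_iff) auto
  qed
  have "2 * weight T {u, c} * length (filter meets xs) \<le> (\<Sum>R\<leftarrow>xs. pair_sum (crossing T u c) R)"
    if "set xs \<subseteq> set C" for xs
    using that
  proof (induction xs)
    case (Cons R xs)
    then have R: "R \<in> set C" by simp
    have "(if meets R then 2 * weight T {u, c} else 0) \<le> pair_sum (crossing T u c) R"
    proof (cases "meets R")
      case True
      then obtain v where v: "v \<in> set R" "v \<in> descendants T c" by (auto simp: meets_def)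
      from crossing_ge[OF c routes(1)[OF R] v] True show ?thesis by simp
    next
      case False
      have "0 \<le> pair_sum (crossing T u c) R"
        by (rule pair_sum_nonneg[OF routes(3)[OF R]]) (use weight_child_pos[OF c] in \<open>auto simp: crossing_def\<close>)
      with False show ?thesis by simp
    qed
    with Cons show ?case by (auto simp: algebra_simps)
  qed simp
  from this[of C] have cross: "2 * weight T {u, c} * k \<le> (\<Sum>R\<leftarrow>C. pair_sum (crossing T u c) R)"
    by (simp add: k_def)
  have "2 * weight T {u, c} * route_bound (?f c) (lower_bound ?f c ss) \<le> 2 * weight T {u, c} * k"
    using rb weight_child_pos[OF c] by (intro mult_left_mono) auto
  then show ?thesis
    using LB cross unfolding pair_sum_add sum_list_addf by (simp add: potential_child[OF c])
qed

text \<open>At most one child contributes: two of them would have a common descendant. For that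
  child \<open>inside\<close> and \<open>crossing\<close> exclude each other, as \<open>u\<close> is
  not its descendant.\<close>

lemma sum_children_le_inside:
  assumes e: "{x, y} \<in> edges T"
  shows "(\<Sum>c\<in>children T u. inside T c x y + crossing T u c x y) \<le> inside T u x y"
proof -
  let ?h = "\<lambda>c. inside T c x y + crossing T u c x y"
  have fin: "finite (children T u)"
    using finite_verts by (rule finite_subset[rotated]) (auto simp: children_def)
  have w: "0 < weight T {x, y}" using edgeD[OF e] by simp
  show ?thesis
  proof (cases "\<forall>c\<in>children T u. ?h c = 0")
    case True
    then show ?thesis using w by (simp add: inside_def)
  next
    case False
    then obtain c where c: "c \<in> children T u" "?h c \<noteq> 0" by blast
    have touch: "{x, y} \<subseteq> insert u (descendants T b) \<and> (x \<in> descendants T b \<or> y \<in> descendants T b)"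
      if "b \<in> children T u" "?h b \<noteq> 0" for b
      using that(2) self_descendant[OF childrenD(3)[OF that(1)]]
      by (auto simp: inside_def crossing_def doubleton_eq_iff split: if_splits)
    have zero: "?h b = 0" if b: "b \<in> children T u - {c}" for b
    proof (rule ccontr)
      assume "?h b \<noteq> 0"
      with touch[of b] touch[OF c] b c(1) have "\<exists>z. z \<in> descendants T b \<and> z \<in> descendants T c"
        using parent_not_descendant[of b u] parent_not_descendant[of c u] by auto
      then show False using descendants_disjoint[of b u c] b c(1) by auto
    qed
    have "sum ?h (children T u) = ?h c + sum ?h (children T u - {c})"
      by (rule sum.remove[OF fin c(1)])
    also have "sum ?h (children T u - {c}) = 0" using zero by (intro sum.neutral) blast
    also have "?h c \<le> weight T {x, y}"
      using parent_not_descendant[OF c(1)] w by (auto simp: inside_def crossing_def doubleton_eq_iff)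
    finally show ?thesis
      using touch[OF c] descendants_mono[OF c(1)] self_descendant[OF childrenD(2)[OF c(1)]]
      by (auto simp: inside_def)
  qed
qed

text \<open>The bounds for the edges to the children add up because their shares of each route are
  disjoint parts of the traffic below \<open>u\<close>.\<close>

lemma lower_bound_le_inside:
  assumes C: "exploration_strategy T B C" and pot: "\<forall>v\<in>verts T. 0 \<le> potential T B v"
  shows "ordered_subtree T t \<Longrightarrow>
    lower_bound (potential T B) (label t) (kids t) \<le> (\<Sum>R\<leftarrow>C. pair_sum (inside T (label t)) R)"
proof (induction t)
  case (Node u ts)
  define h where "h c x y = inside T c x y + crossing T u c x y" for c x y
  define F where "F c = (\<Sum>R\<leftarrow>C. pair_sum (h c) R)" for c
  have dist: "distinct (map label ts)" "set (map label ts) = children T u" using Node.prems by auto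
  have sum: "lower_bound (potential T B) u xs = (\<Sum>t\<leftarrow>xs. lower_bound (potential T B) u [t])" for xs
  proof (induction xs)
    case (Cons t xs)
    then show ?case by (cases t) auto
  qed simp
  have "lower_bound (potential T B) u [t] \<le> F (label t)" if t: "t \<in> set ts" for t
  proof -
    have c: "label t \<in> children T u" using dist(2) t by auto
    have "ordered_subtree T t" using Node.prems t by simp
    from edge_lower_bound_le[OF C _ c Node.IH[OF t this]] pot childrenD(3)[OF c]
    show ?thesis unfolding F_def h_def by simp
  qed
  then have "lower_bound (potential T B) u ts \<le> (\<Sum>t\<leftarrow>ts. F (label t))"
    unfolding sum[of ts] by (intro sum_list_mono) auto
  also have "\<dots> = (\<Sum>c\<in>children T u. F c)"
    using sum_list_distinct_conv_sum_set[OF dist(1), of F] dist(2) by (simp add: comp_def)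
  also have "\<dots> = (\<Sum>R\<leftarrow>C. pair_sum (\<lambda>x y. \<Sum>c\<in>children T u. h c x y) R)"
    unfolding F_def pair_sum_sum by (rule sum_list_sum_swap[symmetric])
  also have "\<dots> \<le> (\<Sum>R\<leftarrow>C. pair_sum (inside T u) R)"
  proof (rule sum_list_mono)
    fix R assume "R \<in> set C"
    then have "walk T R" using C by (auto simp: exploration_strategy_def route_def walk_betw_def)
    then show "pair_sum (\<lambda>x y. \<Sum>c\<in>children T u. h c x y) R \<le> pair_sum (inside T u) R"
      unfolding h_def by (rule pair_sum_mono) (rule sum_children_le_inside)
  qed
  finally show ?case by simp
qed

lemma lower_bound_le_cost:
  assumes C: "exploration_strategy T B C" and pot: "\<forall>v\<in>verts T. 0 \<le> potential T B v"
    and "ordered_subtree T (Node u ts)"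
  shows "lower_bound (potential T B) u ts \<le> cost T C"
proof -
  have "lower_bound (potential T B) u ts \<le> (\<Sum>R\<leftarrow>C. pair_sum (inside T u) R)"
    using lower_bound_le_inside[OF assms] by simp
  also have "\<dots> \<le> (\<Sum>R\<leftarrow>C. len T R)"
  proof (rule sum_list_mono)
    fix R assume "R \<in> set C"
    then have "walk T R" using C by (auto simp: exploration_strategy_def route_def walk_betw_def)
    then show "pair_sum (inside T u) R \<le> len T R"
      unfolding len_eq_pair_sum by (rule pair_sum_mono) (auto simp: inside_def dest: edgeD)
  qed
  finally show ?thesis by (simp add: cost_def)
qed

end

subsection \<open>The cost of adversarial depth first search\<close>

fun traversal :: "'a \<Rightarrow> 'a rose list \<Rightarrow> 'a list" where
  "traversal u [] = [u]"
| "traversal u (Node c ss # ts) = u # traversal c ss @ traversal u ts"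

lemma traversal_eq_Cons: "\<exists>p. traversal u ts = u # p"
  by (induction u ts rule: traversal.induct) auto

lemma traversal_simps [simp]:
  "traversal u ts \<noteq> []" "hd (traversal u ts) = u"
  using traversal_eq_Cons[of u ts] by auto

lemma last_traversal [simp]: "last (traversal u ts) = u"
  by (induction u ts rule: traversal.induct) auto

lemma traversal_eq_concat:
  "traversal u ts = u # concat (map (\<lambda>p. p @ [u]) (map (\<lambda>t. traversal (label t) (kids t)) ts))"
proof (induction ts)
  case (Cons t ts)
  then show ?case by (cases t) auto
qed simp

text \<open>The orders \<open>cs\<close> chosen in the derivation are collected in a rose tree, so
  that the traversal can be treated by structural recursion.\<close>

lemma dfs_from_traversal:
  "dfs_from T u vs \<Longrightarrow> \<exists>ts. vs = traversal u ts \<and> ordered_subtree T (Node u ts)"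
proof (induction rule: dfs_from.induct)
  case (1 cs u tss)
  have "\<exists>ss. map label ss = cs \<and> map (\<lambda>t. traversal (label t) (kids t)) ss = tss \<and>
      (\<forall>s\<in>set ss. ordered_subtree T s)"
    using 1(3)
  proof (induction rule: list_all2_induct)
    case (Cons c cs p tss)
    then obtain ss ts where
      "map label ss = cs" "map (\<lambda>t. traversal (label t) (kids t)) ss = tss"
      "\<forall>s\<in>set ss. ordered_subtree T s" "p = traversal c ts" "ordered_subtree T (Node c ts)"
      by blast
    then show ?case by (intro exI[of _ "Node c ts # ss"]) simp
  qed simp
  then obtain ss where ss: "map label ss = cs" "map (\<lambda>t. traversal (label t) (kids t)) ss = tss"
    "\<forall>s\<in>set ss. ordered_subtree T s" by blast
  then show ?case
    using 1(1,2) by (intro exI[of _ ss]) (simp add: traversal_eq_concat[of u ss])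
qed

text \<open>The same simulation on the bare vertex list. It links the recursion of
  \<open>stops\<close> over the forest with the indices that define the strategy.\<close>

fun list_stops :: "('a \<Rightarrow> real) \<Rightarrow> real \<Rightarrow> 'a list \<Rightarrow> 'a list" where
  "list_stops f g (x # y # p) =
     (if f x \<le> f y then list_stops f g (y # p)
      else if 2 * (f x - f y) \<le> g then list_stops f (g - 2 * (f x - f y)) (y # p)
      else x # list_stops f (2 * f y) (y # p))"
| "list_stops f g _ = []"

text \<open>The continuation \<open>xs\<close> is needed for the induction: after a subtree the list
  goes on from its last vertex \<open>u\<close>.\<close>

lemma list_stops_traversal:
  "decreasing f u ts \<Longrightarrow>
    list_stops f g (traversal u ts @ xs) = stops f u ts g @ list_stops f (slack_out f u ts g) (u # xs)"
proof (induction f u ts arbitrary: g xs rule: decreasing.induct)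
  case (2 f u c ss ts)
  define d where "d = descend f u c g"
  have dec: "f c < f u" "decreasing f c ss" "decreasing f u ts" using 2(3) by auto
  obtain p where p: "traversal c ss = c # p" using traversal_eq_Cons by metis
  obtain q where q: "traversal u ts = u # q" using traversal_eq_Cons by metis
  have "list_stops f g (traversal u (Node c ss # ts) @ xs) =
      (if 2 * (f u - f c) \<le> g then [] else [u]) @ list_stops f d (traversal c ss @ traversal u ts @ xs)"
    using dec(1) by (simp add: p d_def descend_def)
  also have "list_stops f d (traversal c ss @ traversal u ts @ xs) =
      stops f c ss d @ list_stops f (slack_out f c ss d) (c # traversal u ts @ xs)"
    by (rule "2.IH"(1)[OF dec(2)])
  also have "list_stops f (slack_out f c ss d) (c # traversal u ts @ xs) =
      list_stops f (slack_out f c ss d) (traversal u ts @ xs)"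
    using dec(1) by (simp add: q)
  also have "\<dots> = stops f u ts (slack_out f c ss d) @
      list_stops f (slack_out f u ts (slack_out f c ss d)) (u # xs)"
    by (rule "2.IH"(2)[OF dec(3)])
  finally show ?case by (simp add: d_def)
qed simp

section \<open>Segments of the traversal\<close>

lemma segment_self: "j < length vs \<Longrightarrow> segment vs j j = [vs ! j]"
  by (simp add: segment_def take_Suc_conv_app_nth hd_drop_conv_nth take_Suc)

lemma segment_Cons:
  assumes "j < p" "j < length vs"
  shows "segment vs j p = vs ! j # segment vs (Suc j) p"
proof -
  have "drop j vs = vs ! j # drop (Suc j) vs" using assms(2) by (rule Cons_nth_drop_Suc[symmetric])
  moreover have "Suc p - j = Suc (Suc p - Suc j)" using assms(1) by simp
  ultimately show ?thesis by (simp add: segment_def)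
qed

lemma segment_props:
  assumes "j \<le> p" "p < length vs"
  shows "segment vs j p \<noteq> []" "hd (segment vs j p) = vs ! j" "last (segment vs j p) = vs ! p"
proof -
  have len: "length (segment vs j p) = Suc p - j" using assms by (simp add: segment_def)
  then show "segment vs j p \<noteq> []" using assms by auto
  then show "hd (segment vs j p) = vs ! j" "last (segment vs j p) = vs ! p"
    using assms len by (auto simp: hd_conv_nth last_conv_nth segment_def)
qed

lemma len_segment_Cons:
  assumes "j < p" "p < length vs"
  shows "len T (segment vs j p) = weight T {vs ! j, vs ! Suc j} + len T (segment vs (Suc j) p)"
proof -
  have "segment vs (Suc j) p = vs ! Suc j # tl (segment vs (Suc j) p)"
    using segment_props[of "Suc j" p vs] assms by (metis Suc_leI list.collapse)
  then have "segment vs j p = vs ! j # vs ! Suc j # tl (segment vs (Suc j) p)"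
    using segment_Cons[of j p vs] assms by simp
  moreover have "len T (vs ! j # vs ! Suc j # tl (segment vs (Suc j) p)) =
    weight T {vs ! j, vs ! Suc j} + len T (vs ! Suc j # tl (segment vs (Suc j) p))" by simp
  ultimately show ?thesis using \<open>segment vs (Suc j) p = _\<close> by simp
qed

lemma len_segment_join:
  assumes "i \<le> j" "j \<le> p" "p < length vs"
  shows "len T (segment vs i p) = len T (segment vs i j) + len T (segment vs j p)"
  using assms
proof (induction rule: inc_induct)
  case base
  then show ?case by (simp add: segment_self)
next
  case (step i)
  then show ?case using len_segment_Cons[of i p vs T] len_segment_Cons[of i j vs T] by simp
qed

lemma len_join: "p \<noteq> [] \<Longrightarrow> q \<noteq> [] \<Longrightarrow> len T (p @ q) = len T p + weight T {last p, hd q} + len T q"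
  using len_append[of p "last p # q" T] by (cases q) auto

context rooted_tree
begin

lemma len_traversal:
  "subforest T u ts \<Longrightarrow> len T (traversal u ts) = 2 * forest_weight (potential T B) u ts"
proof (induction u ts rule: forest_edges.induct)
  case (2 u c ss ts)
  then have "c \<in> children T u" by simp
  then have "len T (traversal u (Node c ss # ts)) =
    2 * (potential T B u - potential T B c) + len T (traversal c ss) + len T (traversal u ts)"
    using len_join[of "[u]" "traversal c ss @ traversal u ts" T]
      len_join[of "traversal c ss" "traversal u ts" T]
    by (simp add: potential_child insert_commute hd_append)
  with 2 show ?case by simp
qed simp

lemma walk_traversal:
  "subforest T u ts \<Longrightarrow> u \<in> verts T \<Longrightarrow> walk T (traversal u ts)"
proof (induction u ts rule: forest_edges.induct)
  case (2 u c ss ts)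
  then have c: "{u, c} \<in> edges T" "c \<in> verts T" using childrenD by auto
  then have "{c, u} \<in> edges T" by (simp add: insert_commute)
  with 2 c show ?case by (simp add: walk_Cons walk_append hd_append)
qed (simp add: walk_def)

lemma weight_eq_depth:
  assumes "{x, y} \<in> edges T"
  shows "weight T {x, y} = \<bar>depth x - depth y\<bar>" "depth x \<noteq> depth y"
proof -
  have *: "depth b = depth a + weight T {a, b} \<and> 0 < weight T {a, b}" if "b \<in> children T a" for a b
    using depth_child[OF that] weight_child_pos[OF that] by simp
  have "{y, x} = {x, y}" by auto
  then show "weight T {x, y} = \<bar>depth x - depth y\<bar>" "depth x \<noteq> depth y"
    using edge_children[OF assms] *[of y x] *[of x y] by auto
qed

text \<open>The length of the closed walk that results from extending a route by \<open>segment vs j p\<close>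
  exceeds the length at \<open>j\<close> by \<open>len T (segment vs j p) + depth (vs ! p) - depth (vs ! j)\<close>, which
  increases exactly at the steps away from the root.\<close>

definition route_end :: "'a list \<Rightarrow> nat \<Rightarrow> real \<Rightarrow> nat" where
  "route_end vs j g =
     Max {p. p \<le> length vs - 1 \<and> j \<le> p \<and> len T (segment vs j p) + depth (vs ! p) - depth (vs ! j) \<le> g}"

lemma walk_nth_edge:
  assumes "walk T vs" "Suc j < length vs"
  shows "{vs ! j, vs ! Suc j} \<in> edges T"
  using assms by (simp add: walk_def successively_conv_nth)

text \<open>A triangle inequality: the slack used between two positions is never negative, so no
  position is admissible for a negative slack.\<close>

lemma detour_nonneg:
  assumes "walk T vs" "j \<le> p" "p < length vs"
  shows "depth (vs ! j) \<le> len T (segment vs j p) + depth (vs ! p)"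
  using assms(2,3)
proof (induction rule: inc_induct)
  case base
  then show ?case by (simp add: segment_self)
next
  case (step j)
  then show ?case
    using len_segment_Cons[of j p vs T] weight_eq_depth[OF walk_nth_edge[OF assms(1), of j]] by simp
qed

text \<open>The largest admissible index is where the stepwise simulation stops: apart from
  \<open>j\<close> itself, the indices admissible with slack \<open>g\<close> are those admissible
  from \<open>Suc j\<close> with slack \<open>g - d\<close>, where \<open>d\<close> is the slack
  used by one step. At the last index the exploration is over and no stop is recorded.\<close>

lemma route_end:
  assumes "walk T vs" "\<forall>v\<in>verts T. 0 \<le> potential T B v" "j \<le> length vs - 1" "0 \<le> g"
  shows "j \<le> route_end vs j g \<and> route_end vs j g \<le> length vs - 1 \<and>
    list_stops (potential T B) g (drop j vs) = (if route_end vs j g = length vs - 1 then [] else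
      vs ! route_end vs j g #
        list_stops (potential T B) (2 * potential T B (vs ! route_end vs j g)) (drop (route_end vs j g) vs))"
  using assms(3,4)
proof (induction arbitrary: g rule: inc_induct)
  case base
  have l: "length vs - 1 < length vs" using assms(1) by (simp add: walk_def)
  define l where "l = length vs - 1"
  have "{p. p \<le> l \<and> l \<le> p \<and> len T (segment vs l p) + depth (vs ! p) - depth (vs ! l) \<le> g} = {l}"
    using base l segment_self[of l vs] by (auto simp: l_def)
  then have "route_end vs l g = l" by (simp add: route_end_def l_def)
  moreover have "drop l vs = [vs ! l]"
    using l Cons_nth_drop_Suc[of l vs] by (simp add: l_def)
  ultimately show ?case by (simp add: l_def)
next
  case (step j)
  let ?f = "potential T B"
  define S where "S j g = {p. p \<le> length vs - 1 \<and> j \<le> p \<and>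
    len T (segment vs j p) + depth (vs ! p) - depth (vs ! j) \<le> g}" for j g
  have S: "route_end vs j g = Max (S j g)" for j g by (simp add: route_end_def S_def)
  have fin: "finite (S j g)" for j g by (rule finite_subset[of _ "{..length vs - 1}"]) (auto simp: S_def)
  have j: "j < length vs" "Suc j < length vs" using step by auto
  define x where "x = vs ! j"
  define y where "y = vs ! Suc j"
  have e: "{x, y} \<in> edges T" unfolding x_def y_def by (rule walk_nth_edge[OF assms(1) j(2)])
  have fxy: "?f x - ?f y = depth y - depth x" by (simp add: potential_def)
  have fy: "0 \<le> ?f y" using assms(2) edgeD[OF e] by simp
  have drop: "drop j vs = x # drop (Suc j) vs" "drop (Suc j) vs = y # drop (Suc (Suc j)) vs"
    unfolding x_def y_def using j by (simp_all add: Cons_nth_drop_Suc)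
  define d where "d = weight T {x, y} + depth y - depth x"
  have d: "d = (if ?f x \<le> ?f y then 0 else 2 * (?f x - ?f y))"
    using weight_eq_depth[OF e] fxy by (auto simp: d_def)
  have Suc_S: "S j g = insert j (S (Suc j) (g - d))"
  proof (intro equalityI subsetI)
    fix p assume p: "p \<in> S j g"
    show "p \<in> insert j (S (Suc j) (g - d))"
    proof (cases "p = j")
      case False
      then show ?thesis
        using p len_segment_Cons[of j p vs T] j by (auto simp: S_def d_def x_def y_def)
    qed simp
  next
    fix p assume p: "p \<in> insert j (S (Suc j) (g - d))"
    show "p \<in> S j g"
    proof (cases "p = j")
      case True
      then show ?thesis using step.prems j by (auto simp: S_def segment_self)
    next
      case False
      then show ?thesis
        using p len_segment_Cons[of j p vs T] j by (auto simp: S_def d_def x_def y_def)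
    qed
  qed
  show ?case
  proof (cases "d \<le> g")
    case True
    then have g: "0 \<le> g - d" by simp
    have "Suc j \<in> S (Suc j) (g - d)" using g j by (auto simp: S_def segment_self)
    then have "route_end vs j g = route_end vs (Suc j) (g - d)"
      unfolding S Suc_S using fin[of "Suc j" "g - d"]
      by (subst Max_insert) (auto simp: max_def dest: Max_ge)
    moreover have "list_stops ?f g (drop j vs) = list_stops ?f (g - d) (drop (Suc j) vs)"
      using True unfolding drop d by (auto split: if_splits)
    ultimately show ?thesis using step.IH[OF g] by auto
  next
    case False
    have "S (Suc j) (g - d) = {}"
      using False detour_nonneg[OF assms(1), of "Suc j"] j by (force simp: S_def)
    then have end_eq: "route_end vs j g = j" unfolding S Suc_S by simp
    have "?f y < ?f x" "\<not> 2 * (?f x - ?f y) \<le> g" using False step.prems d by (auto split: if_splits)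
    \<comment> \<open>A restart at \<open>x\<close> with slack \<open>2 * ?f x\<close> permits the
      same step and leaves \<open>2 * ?f y\<close>, the value that \<open>list_stops\<close> inserts
      directly.\<close>
    then have "list_stops ?f g (drop j vs) = x # list_stops ?f (2 * ?f x) (drop j vs)"
      using fy unfolding drop by simp
    moreover have "j \<noteq> length vs - 1" "j \<le> length vs - 1" using j by auto
    ultimately show ?thesis unfolding end_eq by (simp add: x_def)
  qed
qed

lemma nth_walk:
  assumes "walk T vs" "p \<le> length vs - 1"
  shows "p < length vs" "vs ! p \<in> verts T" "tdist T (vs ! p) (root T) = depth (vs ! p)"
proof -
  have "0 < length vs" using assms(1) by (simp add: walk_def)
  with assms(2) show p: "p < length vs" by linarith
  then show "vs ! p \<in> verts T" using assms(1) nth_mem by (auto simp: walk_def)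
  then show "tdist T (vs ! p) (root T) = depth (vs ! p)" by (rule tdist_commute[OF root_in_verts])
qed

lemma adfs_index_Suc_0:
  assumes "walk T vs" "hd vs = root T"
  shows "adfs_index T B vs B' (Suc 0) = route_end vs 0 B'"
proof -
  have "vs ! 0 = root T" using assms by (simp add: walk_def hd_conv_nth)
  then show ?thesis
    using nth_walk(3)[OF assms(1)]
    by (auto simp: route_end_def depth_root intro!: arg_cong[of _ _ Max])
qed

text \<open>Subtracting twice the depth of the starting vertex from the length condition leaves
  \<open>B\<close> minus twice that depth, which is twice the potential.\<close>

lemma adfs_index_Suc_Suc:
  assumes "walk T vs"
  shows "adfs_index T B vs B' (Suc (Suc i)) =
    route_end vs (adfs_index T B vs B' (Suc i)) (2 * potential T B (vs ! adfs_index T B vs B' (Suc i)))"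
  unfolding adfs_index.simps(3) Let_def route_end_def
  using nth_walk(3)[OF assms]
  by (auto simp: potential_def algebra_simps intro!: arg_cong[of _ _ Max])

lemma depth_nonneg:
  assumes "v \<in> verts T"
  shows "0 \<le> depth v"
  unfolding tdist_def len_eq_pair_sum
  by (rule pair_sum_nonneg[OF rpath(2)[OF assms]]) (drule edgeD, simp)

lemma len_adfs_route:
  assumes "walk T vs" "adfs_index T B vs B' (i - 1) \<le> adfs_index T B vs B' i"
    and "adfs_index T B vs B' i \<le> length vs - 1"
  shows "len T (adfs_route T B vs B' i) = depth (vs ! adfs_index T B vs B' (i - 1)) +
    len T (segment vs (adfs_index T B vs B' (i - 1)) (adfs_index T B vs B' i)) +
    depth (vs ! adfs_index T B vs B' i)"
proof -
  define j where "j = adfs_index T B vs B' (i - 1)"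
  define p where "p = adfs_index T B vs B' i"
  define P where "P = rpath (vs ! j)"
  define S where "S = segment vs j p"
  define Q where "Q = tree_path T (vs ! p) (root T)"
  have p: "p < length vs" "vs ! p \<in> verts T" "tdist T (vs ! p) (root T) = depth (vs ! p)"
    using nth_walk[OF assms(1), of p] assms(3) by (auto simp: p_def)
  have j: "j \<le> p" "vs ! j \<in> verts T"
    using nth_walk[OF assms(1), of j] assms(2,3) by (auto simp: p_def j_def)
  have P: "P \<noteq> []" "last P = vs ! j" using rpath[OF j(2)] by (auto simp: P_def)
  have S: "S \<noteq> []" "hd S = vs ! j" "last S = vs ! p"
    using segment_props[OF j(1) p(1)] by (auto simp: S_def)
  have Q: "Q \<noteq> []" "hd Q = vs ! p"
    using tree_path(1)[OF p(2) root_in_verts] by (auto simp: Q_def walk_betw_def walk_def)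
  have "last (P @ tl S) = vs ! p" using P S by (cases S) (auto simp: last_append split: if_splits)
  then have "len T ((P @ tl S) @ tl Q) = len T P + len T S + len T Q"
    using P S Q by (subst len_append) (auto simp: len_append)
  moreover have "adfs_route T B vs B' i = (P @ tl S) @ tl Q"
    by (simp add: adfs_route_def Let_def P_def S_def Q_def j_def p_def)
  ultimately show ?thesis using p(3) by (simp add: P_def S_def Q_def j_def p_def tdist_def)
qed

text \<open>A stop is paid with its depth twice, for the return and for the next approach. The
  estimates hold for every number \<open>k\<close> of routes, so the \<open>LEAST\<close> in
  \<open>adfs_count\<close> is never evaluated.\<close>

lemma cost_adfs_le:
  assumes vs: "walk T vs" "hd vs = root T" "last vs = root T"
    and pot: "\<forall>v\<in>verts T. 0 \<le> potential T B v" and B': "0 \<le> B'"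
  shows "cost T (adfs T B vs B') \<le> len T vs + 2 * (\<Sum>s\<leftarrow>list_stops (potential T B) B' vs. depth s)"
proof -
  let ?f = "potential T B"
  define l where "l = length vs - 1"
  define J where "J = adfs_index T B vs B'"
  define D where "D i = depth (vs ! J i)" for i
  define A where "A j = (\<Sum>s\<leftarrow>list_stops ?f (2 * ?f (vs ! j)) (drop j vs). depth s)" for j
  have nth: "vs ! j \<in> verts T" "j < length vs" if "j \<le> l" for j
    using nth_walk[OF vs(1)] that by (auto simp: l_def)
  have vs_l: "vs ! l = root T" "vs ! 0 = root T"
    using vs by (auto simp: l_def walk_def last_conv_nth hd_conv_nth)
  have drop_l: "drop l vs = [vs ! l]"
    using Cons_nth_drop_Suc[of l vs] nth[of l] by (simp add: l_def)
  \<comment> \<open>At the last index both terms on the right vanish, as the last vertex is the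
    root. So the identity also covers indices past the end of the exploration.\<close>
  have route_stop: "(\<Sum>s\<leftarrow>list_stops ?f g (drop j vs). depth s) =
      depth (vs ! route_end vs j g) + A (route_end vs j g)" if "j \<le> l" "0 \<le> g" for j g
    using route_end[OF vs(1) pot that[unfolded l_def]] vs_l(1) drop_l
    unfolding l_def[symmetric] A_def by (auto simp: depth_root)
  have J0: "J 0 = 0" by (simp add: J_def)
  have J1: "J (Suc 0) = route_end vs 0 B'"
    unfolding J_def by (rule adfs_index_Suc_0[OF vs(1,2)])
  have JS: "J (Suc (Suc i)) = route_end vs (J (Suc i)) (2 * ?f (vs ! J (Suc i)))" for i
    unfolding J_def by (rule adfs_index_Suc_Suc[OF vs(1)])
  have J_Suc_le: "J i \<le> l \<Longrightarrow> J i \<le> J (Suc i) \<and> J (Suc i) \<le> l" for i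
  proof (cases i)
    case 0
    then show ?thesis using route_end[OF vs(1) pot _ B', of 0] J0 J1 by (simp add: l_def)
  next
    case (Suc n)
    assume "J i \<le> l"
    then show ?thesis
      using route_end[OF vs(1) pot, of "J i" "2 * ?f (vs ! J i)"] pot nth(1) JS[of n]
      unfolding Suc l_def[symmetric] by simp
  qed
  have J_le: "J i \<le> l" for i
    by (induction i) (use J0 J_Suc_le in auto)
  have J_mono: "J i \<le> J (Suc i)" for i using J_Suc_le J_le by blast
  have stops: "(\<Sum>i\<leftarrow>[1..<Suc k]. D i) + A (J k) = (\<Sum>s\<leftarrow>list_stops ?f B' vs. depth s)" if "1 \<le> k" for k
    using that
  proof (induction k rule: dec_induct)
    case base
    then show ?case using route_stop[OF _ B', of 0] J1 by (simp add: D_def)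
  next
    case (step k)
    then obtain n where k: "k = Suc n" by (cases k) auto
    have "A (J k) = D (Suc k) + A (J (Suc k))"
      unfolding k JS D_def A_def[of "J (Suc n)"]
      by (rule route_stop) (use J_le pot nth(1) in auto)
    then show ?case using step by simp
  qed
  have A_nonneg: "0 \<le> A j" for j
  proof -
    have "set (list_stops f g p) \<subseteq> set p" for f g and p :: "'a list"
      by (induction f g p rule: list_stops.induct) auto
    then have "set (list_stops ?f (2 * ?f (vs ! j)) (drop j vs)) \<subseteq> verts T"
      using vs(1) set_drop_subset[of j vs] unfolding walk_def by blast
    then show ?thesis unfolding A_def using depth_nonneg by (intro sum_list_nonneg) auto
  qed
  have D_le: "(\<Sum>i\<leftarrow>[1..<Suc k]. D i) \<le> (\<Sum>s\<leftarrow>list_stops ?f B' vs. depth s)" for k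
  proof (cases "k = 0")
    case True
    have "0 \<le> D 1" unfolding D_def using depth_nonneg nth J_le by blast
    with True show ?thesis using stops[of 1] A_nonneg[of "J 1"] by simp
  next
    case False
    then show ?thesis using stops[of k] A_nonneg[of "J k"] by simp
  qed
  \<comment> \<open>The last of the \<open>k\<close> returns is not followed by an approach, hence
    \<open>- D k\<close>.\<close>
  have cost: "(\<Sum>i\<leftarrow>[1..<Suc k]. len T (adfs_route T B vs B' i)) =
      len T (segment vs 0 (J k)) + 2 * (\<Sum>i\<leftarrow>[1..<Suc k]. D i) - D k" for k
  proof (induction k)
    case 0
    then show ?case using nth(2)[of 0] by (simp add: J0 D_def vs_l(2) depth_root segment_self)
  next
    case (Suc k)
    have "len T (adfs_route T B vs B' (Suc k)) = D k + len T (segment vs (J k) (J (Suc k))) + D (Suc k)"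
      using len_adfs_route[OF vs(1), of B B' "Suc k"] J_mono[of k] J_le[of "Suc k"]
      by (simp add: D_def J_def l_def)
    moreover have "len T (segment vs 0 (J (Suc k))) =
        len T (segment vs 0 (J k)) + len T (segment vs (J k) (J (Suc k)))"
      by (rule len_segment_join) (use J_mono nth(2) J_le in auto)
    ultimately show ?case using Suc.IH by simp
  qed
  define k where "k = adfs_count T B vs B'"
  have "len T (segment vs 0 l) = len T (segment vs 0 (J k)) + len T (segment vs (J k) l)"
    by (rule len_segment_join) (use J_le nth(2) in auto)
  moreover have "segment vs 0 l = vs" by (simp add: segment_def l_def)
  \<comment> \<open>Returning to the root from position \<open>J k\<close> is no longer than
    finishing the traversal.\<close>
  moreover have "depth (vs ! J k) \<le> len T (segment vs (J k) l) + depth (vs ! l)"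
    by (rule detour_nonneg[OF vs(1)]) (use J_le nth(2) in auto)
  ultimately have "len T (segment vs 0 (J k)) + D k \<le> len T vs"
    by (simp add: D_def vs_l(1) depth_root)
  moreover have "cost T (adfs T B vs B') = (\<Sum>i\<leftarrow>[1..<Suc k]. len T (adfs_route T B vs B' i))"
    by (simp add: cost_def adfs_def k_def comp_def)
  moreover have "0 \<le> D k" unfolding D_def using depth_nonneg nth J_le by blast
  ultimately show ?thesis using cost[of k] D_le[of k] by linarith
qed

text \<open>The cost is constant on the \<open>B'\<close> with the same first index, and there are
  finitely many such indices; \<open>inv_into\<close> picks one \<open>B'\<close> for each.\<close>

lemma finite_adfs_costs:
  assumes "walk T vs" "hd vs = root T" "\<forall>v\<in>verts T. 0 \<le> potential T B v"
  shows "finite ((\<lambda>B'. cost T (adfs T B vs B')) ` {0..B})"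
proof -
  define J where "J B' = adfs_index T B vs B' (Suc 0)" for B'
  define h where "h B' = cost T (adfs T B vs B')" for B'
  have "J ` {0..B} \<subseteq> {..length vs - 1}"
    using route_end[OF assms(1,3), of 0] adfs_index_Suc_0[OF assms(1,2)] by (auto simp: J_def)
  then have fin: "finite (J ` {0..B})" by (rule finite_subset) simp
  have cong: "h x = h y" if "J x = J y" for x y
  proof -
    have "adfs_index T B vs x i = adfs_index T B vs y i" for i
    proof (induction i rule: induct_nat_012)
      case 1
      then show ?case using that by (simp only: J_def)
    next
      case (ge2 i)
      show ?case by (simp only: adfs_index.simps(3) ge2(2))
    qed simp
    then have "adfs T B vs x = adfs T B vs y"
      by (simp add: adfs_def adfs_count_def adfs_route_def)
    then show ?thesis by (simp add: h_def)
  qed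
  have "h x = h (inv_into {0..B} J (J x))" if "x \<in> {0..B}" for x
    by (rule cong) (rule f_inv_into_f[OF imageI[OF that], symmetric])
  then have "h ` {0..B} \<subseteq> (\<lambda>i. h (inv_into {0..B} J i)) ` J ` {0..B}" by blast
  then have "finite (h ` {0..B})" using fin by (rule finite_subset[OF _ finite_imageI])
  then show ?thesis by (simp add: h_def)
qed

end

theorem theorem3:
  fixes T :: "'a wtree" and B :: real and vs :: "'a list" and C :: "'a list list"
  assumes "weighted_rooted_tree T"
    and "B > 1"
    and "\<forall>u\<in>verts T. tdist T (root T) u \<le> B / 2"
    and "dfs_traversal T vs"
    and "heavy_tree T B"
    and "optimal_strategy T B C"
  shows "(heavydeg T B (root T) = 1 \<longrightarrow>
            adfs_cost T B vs < 10 * cost T C - 8 * tree_potential T B) \<and>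
         (heavydeg T B (root T) \<noteq> 1 \<longrightarrow>
            adfs_cost T B vs < 10 * cost T C - 16 * tree_potential T B)"
proof -
  interpret rooted_tree T by unfold_locales (rule assms(1))
  let ?f = "potential T B" and ?r = "root T"
  have pot: "\<forall>v\<in>verts T. 0 \<le> ?f v" using assms(3) by (simp add: potential_def)
  obtain ts where vs: "vs = traversal ?r ts" and ord: "ordered_subtree T (Node ?r ts)"
    using dfs_from_traversal[OF assms(4)[unfolded dfs_traversal_def]] by blast
  have sub: "subforest T ?r ts" using ordered_subtree_subforest[OF ord] by simp
  have walk: "walk T vs" "hd vs = ?r" "last vs = ?r"
    using walk_traversal[OF sub root_in_verts] by (auto simp: vs)
  have root_pot: "?f ?r = B / 2" by (simp add: potential_def depth_root)
  have C: "exploration_strategy T B C" using assms(6) by (simp add: optimal_strategy_def)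
  \<comment> \<open>With weight \<open>W\<close> and lower bound \<open>L\<close> at the root, the
    cost is at most \<open>2 * W + 2 * (5 * L - 9 * W) = 10 * L - 16 * W\<close>; here
    \<open>L\<close> is at most the optimal cost, and heaviness gives
    \<open>?f ?r < W\<close>.\<close>
  have "cost T (adfs T B vs B') < 10 * cost T C - 16 * ?f ?r" if B': "0 \<le> B'" "B' \<le> B" for B'
  proof -
    have "list_stops ?f B' vs = stops ?f ?r ts B'"
      using list_stops_traversal[of ?f ?r ts B' "[]"] decreasing_potential[OF pot sub]
      by (simp add: vs)
    then have "cost T (adfs T B vs B') \<le> len T vs + 2 * (\<Sum>s\<leftarrow>stops ?f ?r ts B'. depth s)"
      using cost_adfs_le[OF walk pot B'(1)] by simp
    moreover have "len T vs = 2 * forest_weight ?f ?r ts"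
      unfolding vs by (rule len_traversal[OF sub])
    moreover have "(\<Sum>s\<leftarrow>stops ?f ?r ts B'. depth s) \<le>
        5 * lower_bound ?f ?r ts - 9 * forest_weight ?f ?r ts"
      using sum_stops_le[of ?f ?r ts B', OF decreasing_potential[OF pot sub] B'(1)] B'(2)
      by (simp add: root_pot potential_def depth_root)
    moreover have "lower_bound ?f ?r ts \<le> cost T C" by (rule lower_bound_le_cost[OF C pot ord])
    moreover have "?f ?r < forest_weight ?f ?r ts"
      using omega_le_forest_weight[OF ord, of B] assms(5)
      unfolding heavy_tree_def tree_potential_def by linarith
    ultimately show ?thesis by linarith
  qed
  moreover have "{0..B} \<noteq> {}" using assms(2) by simp
  ultimately have "adfs_cost T B vs < 10 * cost T C - 16 * ?f ?r"
    unfolding adfs_cost_def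
    by (subst Max_less_iff[OF finite_adfs_costs[OF walk(1,2) pot]]) force+
  then have "adfs_cost T B vs < 10 * cost T C - 16 * tree_potential T B"
    by (simp only: tree_potential_def)
  \<comment> \<open>By this sign the bound with 16 implies the one with 8.\<close>
  moreover have "0 \<le> tree_potential T B"
    using assms(2) root_pot by (simp add: tree_potential_def)
  ultimately show ?thesis by linarith
qed

end
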